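(* Let $\mathcal{A}$ be a separable unital AF C*-algebra, let $\mathcal{B}$ be a unital C*-algebra with property HUC, and let $\pi\in\mathrm{Rep}(\mathcal{A},\mathcal{B})$. Then $\mathcal{U}_{\mathcal{B}}(\pi)^-$ is path-connected.
   Context: For unital C*-algebras $\mathcal{A},\mathcal{B}$ with $\mathcal{A}$ separable, $\mathrm{Rep}(\mathcal{A},\mathcal{B})$ is the set of unital $*$-homomorphisms $\mathcal{A}\to\mathcal{B}$ with the topology of pointwise norm convergence. $\mathcal{U}_{\mathcal{B}}$ is the unitary group of $\mathcal{B}$, $\mathcal{U}_{\mathcal{B}}(\pi)=\{U^*\pi(\cdot)U:U\in\mathcal{U}_{\mathcal{B}}\}$, and $\mathcal{U}_{\mathcal{B}}(\pi)^-$ is its closure in $\mathrm{Rep}(\mathcal{A},\mathcal{B})$. A unital C*-algebra $\mathcal{B}$ has property UC if $\mathcal{U}_{\mathcal{B}}$ is connected, and property HUC if for every projection $P\in\mathcal{B}$ the corner $P\mathcal{B}P$ has property UC. *)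

theory Defs
  imports "HOL-Analysis.Analysis"
begin

class unital_cstar_algebra = real_normed_algebra_1 + banach +
  fixes cscale :: "complex \<Rightarrow> 'a \<Rightarrow> 'a" (infixr "*\<^sub>C" 75)
    and adj :: "'a \<Rightarrow> 'a"
  assumes cscale_add_right: "c *\<^sub>C (x + y) = c *\<^sub>C x + c *\<^sub>C y"
    and cscale_add_left: "(c + d) *\<^sub>C x = c *\<^sub>C x + d *\<^sub>C x"
    and cscale_cscale: "c *\<^sub>C (d *\<^sub>C x) = (c * d) *\<^sub>C x"
    and cscale_one: "1 *\<^sub>C x = x"
    and scaleR_cscale: "scaleR r x = (complex_of_real r) *\<^sub>C x"
    and norm_cscale: "norm (c *\<^sub>C x) = cmod c * norm x"
    and mult_cscale_left: "(c *\<^sub>C x) * y = c *\<^sub>C (x * y)"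
    and mult_cscale_right: "x * (c *\<^sub>C y) = c *\<^sub>C (x * y)"
    and adj_adj: "adj (adj x) = x"
    and adj_add: "adj (x + y) = adj x + adj y"
    and adj_cscale: "adj (c *\<^sub>C x) = cnj c *\<^sub>C adj x"
    and adj_mult: "adj (x * y) = adj y * adj x"
    and cstar_identity: "norm (adj x * x) = (norm x)\<^sup>2"

definition separable_alg :: "'a::unital_cstar_algebra itself \<Rightarrow> bool" where
  "separable_alg _ \<longleftrightarrow> (\<exists>C :: 'a set. countable C \<and> closure C = UNIV)"

definition cspan :: "'a::unital_cstar_algebra set \<Rightarrow> 'a set" where
  "cspan F = {x. \<exists>G c. finite G \<and> G \<subseteq> F \<and> x = (\<Sum>g\<in>G. c g *\<^sub>C g)}"

text \<open>Finite-dimensional C*-subalgebra (finite-dimensional subspaces are closed).\<close>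
definition fd_cstar_subalgebra :: "'a::unital_cstar_algebra set \<Rightarrow> bool" where
  "fd_cstar_subalgebra S \<longleftrightarrow>
     0 \<in> S \<and>
     (\<forall>x\<in>S. \<forall>y\<in>S. x + y \<in> S \<and> x * y \<in> S) \<and>
     (\<forall>c. \<forall>x\<in>S. c *\<^sub>C x \<in> S) \<and>
     (\<forall>x\<in>S. adj x \<in> S) \<and>
     (\<exists>F. finite F \<and> S = cspan F)"

definition AF_alg :: "'a::unital_cstar_algebra itself \<Rightarrow> bool" where
  "AF_alg _ \<longleftrightarrow> (\<exists>S :: nat \<Rightarrow> 'a set.
      (\<forall>n. fd_cstar_subalgebra (S n)) \<and> (\<forall>n. S n \<subseteq> S (Suc n)) \<and>
      closure (\<Union>n. S n) = UNIV)"

definition Rep :: "('a::unital_cstar_algebra \<Rightarrow> 'b::unital_cstar_algebra) set" where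
  "Rep = {\<pi>. (\<forall>x y. \<pi> (x + y) = \<pi> x + \<pi> y) \<and>
             (\<forall>c x. \<pi> (c *\<^sub>C x) = c *\<^sub>C \<pi> x) \<and>
             (\<forall>x y. \<pi> (x * y) = \<pi> x * \<pi> y) \<and>
             (\<forall>x. \<pi> (adj x) = adj (\<pi> x)) \<and>
             \<pi> 1 = 1}"

definition unitaries :: "'b::unital_cstar_algebra set" where
  "unitaries = {u. adj u * u = 1 \<and> u * adj u = 1}"

definition unitary_orbit :: "('a::unital_cstar_algebra \<Rightarrow> 'b::unital_cstar_algebra) \<Rightarrow> ('a \<Rightarrow> 'b) set" where
  "unitary_orbit \<pi> = {(\<lambda>a. adj U * \<pi> a * U) | U. U \<in> unitaries}"

text \<open>Closure of the unitary orbit in Rep(A,B), where functions carry the product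
topology, i.e. the topology of pointwise norm convergence.\<close>
definition unitary_orbit_closure :: "('a::unital_cstar_algebra \<Rightarrow> 'b::unital_cstar_algebra) \<Rightarrow> ('a \<Rightarrow> 'b) set" where
  "unitary_orbit_closure \<pi> = Rep \<inter> closure (unitary_orbit \<pi>)"

definition projection :: "'b::unital_cstar_algebra \<Rightarrow> bool" where
  "projection P \<longleftrightarrow> P * P = P \<and> adj P = P"

definition corner_unitaries :: "'b::unital_cstar_algebra \<Rightarrow> 'b set" where
  "corner_unitaries P = {u. (\<exists>x. u = P * x * P) \<and> adj u * u = P \<and> u * adj u = P}"

definition property_UC_corner :: "'b::unital_cstar_algebra \<Rightarrow> bool" where
  "property_UC_corner P \<longleftrightarrow> connected (corner_unitaries P)"

definition property_HUC :: "'b::unital_cstar_algebra itself \<Rightarrow> bool" where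
  "property_HUC _ \<longleftrightarrow> (\<forall>P :: 'b. projection P \<longrightarrow> property_UC_corner P)"

end

theory Submission
  imports Defs
begin

text \<open>Adjoining scalars, write the AF algebra as the closure of an increasing sequence of
  finite-dimensional unital subalgebras \<open>T n\<close> starting with the scalars. If \<open>\<rho>\<close> lies in the closure of
  the unitary orbit of \<open>\<pi>\<close>, averaging a unitary that almost conjugates \<open>\<pi>\<close> to \<open>\<rho>\<close> over the matrix
  units of \<open>T n\<close>, followed by polar decomposition, gives unitaries \<open>U n\<close> conjugating \<open>\<pi>\<close> to \<open>\<rho>\<close>
  exactly on \<open>T n\<close>. Hence \<open>U (n + 1) (U n)\<^sup>*\<close> is a unitary in the commutant of \<open>\<pi> (T n)\<close>. That
  commutant is a finite direct sum of corners, one for each block of \<open>T n\<close>, so HUC makes its unitary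
  group path-connected. Conjugating along the resulting paths joins the \<open>n\<close>-th conjugate of \<open>\<pi>\<close> to the
  next one without changing the values on \<open>T n\<close>; because *-homomorphisms are contractive, the infinite
  concatenation of these paths converges pointwise to \<open>\<rho>\<close>.\<close>

section \<open>Elementary C*-algebra\<close>

text \<open>Nothing forces the \<open>U n\<close> to converge, so the concatenated path of unitaries
  has no limit at its end. Only the conjugates of \<pi> are asked to converge, and on
  \<open>T n\<close> they are constant from stage n on. The scalars open the chain because all
  unital representations agree on them: 1 is then a legitimate first intertwiner, and the path
  starts at \<pi> itself. HUC enters through the corners at minimal projections: the part of the
  commutant over a matrix block with minimal projection p is a copy of the corner of the target at
  \<pi> p, embedded by summing the translates of x under the matrix units of the block. The analysis
  rests on one function, the square root of 1 - x for norm x < 1, and on the C*-identity for normal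
  elements g + \<i> h with g, h commuting and self-adjoint, which stands in for positivity and the
  spectrum. Together they give contractivity of *-homomorphisms, polar decomposition, scalar corners
  at minimal projections, and paths between nearby unitaries.\<close>

lemma cscale_zero_left [simp]: "0 *\<^sub>C (x::'a::unital_cstar_algebra) = 0"
  using cscale_add_left[of 0 0 x] by simp

lemma cscale_zero_right [simp]: "c *\<^sub>C (0::'a::unital_cstar_algebra) = 0"
  using cscale_add_right[of c 0 "0::'a"] by simp

lemma cscale_minus_left: "(- c) *\<^sub>C (x::'a::unital_cstar_algebra) = - (c *\<^sub>C x)"
  using cscale_add_left[of "- c" c x] by (simp add: eq_neg_iff_add_eq_0)

lemma cscale_minus_right: "c *\<^sub>C (- x::'a::unital_cstar_algebra) = - (c *\<^sub>C x)"
  using cscale_add_right[of c "- x" x] by (simp add: eq_neg_iff_add_eq_0)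

lemma cscale_diff_right: "c *\<^sub>C (x - y::'a::unital_cstar_algebra) = c *\<^sub>C x - c *\<^sub>C y"
  using cscale_add_right[of c x "- y"] by (simp add: cscale_minus_right)

lemma cscale_eq_0_iff: "c *\<^sub>C (x::'a::unital_cstar_algebra) = 0 \<longleftrightarrow> c = 0 \<or> x = 0"
  by (metis norm_cscale norm_eq_zero mult_eq_0_iff)

lemma cscale_right_cancel:
  fixes x :: "'a::unital_cstar_algebra"
  assumes "c *\<^sub>C x = d *\<^sub>C x" "x \<noteq> 0"
  shows "c = d"
proof -
  have "(c - d) *\<^sub>C x = 0"
    using assms cscale_add_left[of c "- d" x] by (simp add: cscale_minus_left)
  then show ?thesis using assms by (simp add: cscale_eq_0_iff)
qed

lemma adj_zero [simp]: "adj (0::'a::unital_cstar_algebra) = 0"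
  using adj_add[of 0 "0::'a"] by simp

lemma adj_minus: "adj (- x::'a::unital_cstar_algebra) = - adj x"
  using adj_add[of "- x" x] by (simp add: eq_neg_iff_add_eq_0)

lemma adj_diff: "adj (x - y::'a::unital_cstar_algebra) = adj x - adj y"
  using adj_add[of x "- y"] by (simp add: adj_minus)

lemma adj_one [simp]: "adj (1::'a::unital_cstar_algebra) = 1"
  by (metis adj_adj adj_mult mult.left_neutral)

lemma adj_scaleR: "adj (r *\<^sub>R x::'a::unital_cstar_algebra) = r *\<^sub>R adj x"
  by (simp add: scaleR_cscale adj_cscale)

lemma adj_sum: "adj (\<Sum>i\<in>I. f i::'a::unital_cstar_algebra) = (\<Sum>i\<in>I. adj (f i))"
  by (induction I rule: infinite_finite_induct) (auto simp: adj_add)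

lemma adj_eq_0_iff: "adj (x::'a::unital_cstar_algebra) = 0 \<longleftrightarrow> x = 0"
  by (metis adj_adj adj_zero)

lemma norm_adj [simp]: "norm (adj (x::'a::unital_cstar_algebra)) = norm x"
proof -
  have le: "norm y \<le> norm (adj y)" for y :: 'a
  proof (cases "y = 0")
    case False
    have "norm y * norm y \<le> norm (adj y) * norm y"
      using norm_mult_ineq[of "adj y" y] by (simp add: cstar_identity power2_eq_square)
    then show ?thesis using False by simp
  qed simp
  show ?thesis using le[of x] le[of "adj x"] by (simp add: adj_adj)
qed

lemma bounded_linear_adj: "bounded_linear (adj :: 'a::unital_cstar_algebra \<Rightarrow> 'a)"
  by (rule bounded_linear_intro[where K=1]) (auto simp: adj_add adj_scaleR)

lemmas continuous_on_adj [continuous_intros] =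
  bounded_linear.continuous_on[OF bounded_linear_adj]

lemma adj_mult_self_eq_0_iff: "adj x * x = 0 \<longleftrightarrow> (x::'a::unital_cstar_algebra) = 0"
proof
  assume "adj x * x = 0"
  then have "(norm x)\<^sup>2 = 0" by (metis cstar_identity norm_zero)
  then show "x = 0" by simp
qed simp

section \<open>Unitary and normal elements, inverses\<close>

lemma unitariesD:
  assumes "u \<in> unitaries"
  shows "adj u * u = 1" "u * adj u = 1" "adj u * (u * x) = x" "u * (adj u * x) = x"
  using assms by (auto simp: unitaries_def mult.assoc[symmetric])

lemma unitaries_one [simp]: "1 \<in> unitaries"
  by (simp add: unitaries_def)

lemma unitaries_adj: "u \<in> unitaries \<Longrightarrow> adj u \<in> unitaries"
  by (simp add: unitaries_def adj_adj)

lemma unitaries_mult: "u \<in> unitaries \<Longrightarrow> v \<in> unitaries \<Longrightarrow> u * v \<in> unitaries"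
  by (auto simp: unitaries_def adj_mult mult.assoc) (metis mult.assoc mult.left_neutral)+

lemma norm_unitary: "u \<in> unitaries \<Longrightarrow> norm u = 1"
  using cstar_identity[of u] norm_ge_zero[of u]
  by (simp add: unitaries_def power2_eq_1_iff del: norm_ge_zero)

lemma norm_unitary_mult_left:
  assumes "u \<in> unitaries"
  shows "norm (u * x) = norm x"
proof (rule antisym)
  show "norm (u * x) \<le> norm x"
    using norm_mult_ineq[of u x] assms by (simp add: norm_unitary)
  show "norm x \<le> norm (u * x)"
    using norm_mult_ineq[of "adj u" "u * x"] assms by (simp add: norm_unitary unitariesD)
qed

lemma adj_mult_add_ii:
  fixes g h :: "'a::unital_cstar_algebra"
  assumes "adj g = g" "adj h = h" "g * h = h * g"
  shows "adj (g + \<i> *\<^sub>C h) * (g + \<i> *\<^sub>C h) = g * g + h * h"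
    and "(g + \<i> *\<^sub>C h) * adj (g + \<i> *\<^sub>C h) = g * g + h * h"
  using assms
  by (simp_all add: adj_add adj_cscale algebra_simps mult_cscale_left mult_cscale_right
      cscale_cscale cscale_minus_left cscale_one cscale_add_right cscale_diff_right)

text \<open>This replaces monotonicity of the norm on positive elements. The element w = g + \<i> h
  is normal with adj w * w = g^2 + h^2, and g is its real part, so norm g is at most norm w.\<close>

lemma norm_square_le_sum_squares:
  fixes g h :: "'a::unital_cstar_algebra"
  assumes "adj g = g" "adj h = h" "g * h = h * g"
  shows "(norm g)\<^sup>2 \<le> norm (g * g + h * h)"
proof -
  define w where "w = g + \<i> *\<^sub>C h"
  have "(2::real) *\<^sub>R g = w + adj w"
    using assms by (simp add: w_def adj_add adj_cscale cscale_minus_left scaleR_2)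
  then have "2 * norm g = norm (w + adj w)" by (metis norm_scaleR abs_numeral)
  also have "\<dots> \<le> 2 * norm w" using norm_triangle_ineq[of w "adj w"] by simp
  finally have "norm g \<le> norm w" by simp
  then have "(norm g)\<^sup>2 \<le> (norm w)\<^sup>2" by (simp add: power_mono)
  also have "\<dots> = norm (g * g + h * h)"
    using adj_mult_add_ii(1)[OF assms] cstar_identity[of w] by (simp add: w_def)
  finally show ?thesis .
qed

text \<open>With z = 1 - x, a right inverse is a fixed point of y \<mapsto> 1 + z y and a left
  inverse one of y \<mapsto> 1 + y z. Both maps are contractions with constant norm z.\<close>

lemma Neumann_inverse:
  fixes x :: "'a::unital_cstar_algebra"
  assumes "norm (1 - x) < 1"
  obtains y where "x * y = 1" "y * x = 1"
proof -
  let ?z = "1 - x"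
  have "\<exists>!y. 1 + ?z * y = y"
    using assms by (intro banach_fix_type[where c="norm ?z"])
      (auto simp: dist_norm norm_mult_ineq simp flip: right_diff_distrib)
  then obtain y where "1 + ?z * y = y" by blast
  then have y: "x * y = 1" by (simp add: left_diff_distrib)
  have "\<exists>!y. 1 + y * ?z = y"
    using assms by (intro banach_fix_type[where c="norm ?z"])
      (auto simp: dist_norm norm_mult_ineq mult.commute[of "norm ?z"] simp flip: left_diff_distrib)
  then obtain y' where "1 + y' * ?z = y'" by blast
  then have y': "y' * x = 1" by (simp add: right_diff_distrib)
  have "y' = y" using y y' by (metis mult.assoc mult.left_neutral mult.right_neutral)
  then show ?thesis using that y y' by blast
qed

lemma inverse_commutes:
  fixes b :: "'a::monoid_mult"
  assumes "b * d = 1" "d * b = 1" "z * b = b * z"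
  shows "z * d = d * z"
  by (metis assms mult.assoc mult.left_neutral mult.right_neutral)

section \<open>Square roots and their consequences\<close>

text \<open>A square root of \<^term>\<open>1 - x\<close>; meaningful only for \<^prop>\<open>norm x < 1\<close>. Writing the root
  as \<^term>\<open>1 - y\<close>, the equation becomes the fixed point equation of a contraction.\<close>

definition sqrt1m :: "'a::unital_cstar_algebra \<Rightarrow> 'a" where
  "sqrt1m x = (THE s. norm (1 - s) < 1 \<and> s * s = 1 - x)"

text \<open>The identity 2 (s - t) = (s^2 - t^2) + (1 - s)(s - t) + (s - t)(1 - t) holds even for
  noncommuting s and t. It yields both uniqueness and Lipschitz continuity of the root.\<close>

lemma sqrt1m_Lipschitz_aux:
  fixes s t :: "'a::unital_cstar_algebra"
  assumes "norm (1 - s) \<le> r" "norm (1 - t) \<le> r"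
  shows "(1 - r) * norm (s - t) \<le> norm (s * s - t * t) / 2"
proof -
  have "2 *\<^sub>R (s - t) = (s * s - t * t) + ((1 - s) * (s - t) + (s - t) * (1 - t))"
    by (simp add: algebra_simps scaleR_2)
  then have "norm (2 *\<^sub>R (s - t)) \<le> norm (s * s - t * t) + norm ((1 - s) * (s - t) + (s - t) * (1 - t))"
    by (metis norm_triangle_ineq)
  also have "norm ((1 - s) * (s - t) + (s - t) * (1 - t))
      \<le> norm (1 - s) * norm (s - t) + norm (s - t) * norm (1 - t)"
    by (meson add_mono norm_mult_ineq norm_triangle_le)
  also have "\<dots> \<le> r * norm (s - t) + norm (s - t) * r"
    using assms by (intro add_mono mult_right_mono mult_left_mono) auto
  finally show ?thesis unfolding norm_scaleR by (simp add: algebra_simps)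
qed

lemma sqrt1m_unique_aux:
  fixes s t :: "'a::unital_cstar_algebra"
  assumes "norm (1 - s) < 1" "norm (1 - t) < 1" "s * s = t * t"
  shows "s = t"
proof -
  define r where "r = max (norm (1 - s)) (norm (1 - t))"
  have "r < 1" "(1 - r) * norm (s - t) \<le> 0"
    using assms sqrt1m_Lipschitz_aux[of s r t] by (auto simp: r_def)
  then have "norm (s - t) \<le> 0" by (simp add: mult_le_0_iff)
  then show ?thesis by simp
qed

lemma sqrt1m_exists:
  fixes x :: "'a::unital_cstar_algebra"
  assumes "norm x < 1"
  shows "\<exists>s. norm (1 - s) \<le> norm x \<and> s * s = 1 - x \<and> (\<forall>z. z * x = x * z \<longrightarrow> z * s = s * z)"
proof -
  \<comment> \<open>\<open>?K\<close> is a closed ball cut down to the bicommutant of x. The map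
    \<open>?f\<close> preserves it, so the fixed point commutes with everything that commutes with
    x.\<close>
  let ?K = "{y. norm y \<le> norm x} \<inter> (\<Inter>z\<in>{z. z * x = x * z}. {y. z * y = y * z})"
  let ?f = "\<lambda>y. (1/2) *\<^sub>R (x + y * y)"
  have "closed ?K"
    by (intro closed_Int closed_INT ballI closed_Collect_le closed_Collect_eq continuous_intros)
  then have K1: "complete ?K" by (simp add: complete_eq_closed)
  have K2: "?K \<noteq> {}" by (auto intro!: exI[of _ 0])
  have K3: "?f ` ?K \<subseteq> ?K"
  proof (rule image_subsetI)
    fix y assume y: "y \<in> ?K"
    have "norm (x + y * y) \<le> norm x + norm y * norm y"
      by (meson add_left_mono norm_mult_ineq norm_triangle_le)
    also have "\<dots> \<le> norm x + norm x * 1"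
      using y assms by (intro add_left_mono mult_mono) auto
    finally have "norm (?f y) \<le> norm x" by simp
    moreover have "z * ?f y = ?f y * z" if "z * x = x * z" for z
    proof -
      have "z * y = y * z" using y that by blast
      then have "z * (y * y) = y * y * z" by (metis mult.assoc)
      then show ?thesis using that by (simp add: algebra_simps)
    qed
    ultimately show "?f y \<in> ?K" by blast
  qed
  have K4: "dist (?f y) (?f y') \<le> norm x * dist y y'" if "y \<in> ?K" "y' \<in> ?K" for y y'
  proof -
    have "?f y - ?f y' = (1/2) *\<^sub>R (y * (y - y') + (y - y') * y')"
      by (simp add: algebra_simps)
    then have "dist (?f y) (?f y') = norm (y * (y - y') + (y - y') * y') / 2"
      unfolding dist_norm by (simp only: norm_scaleR)
    also have "norm (y * (y - y') + (y - y') * y') \<le> norm y * norm (y - y') + norm (y - y') * norm y'"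
      by (meson add_mono norm_mult_ineq norm_triangle_le)
    also have "\<dots> \<le> norm x * norm (y - y') + norm (y - y') * norm x"
      using that by (intro add_mono mult_mono) auto
    finally show ?thesis by (simp add: dist_norm algebra_simps)
  qed
  have "\<exists>!y. y \<in> ?K \<and> ?f y = y"
    by (rule Banach_fix[OF K1 K2 norm_ge_zero assms K3 K4])
  then obtain y where y: "y \<in> ?K" "?f y = y" by blast
  have "2 *\<^sub>R y = 2 *\<^sub>R ?f y" using y(2) by (simp only:)
  then have "2 *\<^sub>R y = x + y * y" by simp
  then have "(1 - y) * (1 - y) = 1 - x" by (simp add: algebra_simps scaleR_2)
  moreover have "z * (1 - y) = (1 - y) * z" if "z * x = x * z" for z
    using y(1) that by (simp add: algebra_simps)
  moreover have "norm (1 - (1 - y)) \<le> norm x" using y(1) by simp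
  ultimately show ?thesis by blast
qed

lemma sqrt1m_eqI:
  assumes "norm (1 - s) < 1" "s * s = 1 - x"
  shows "sqrt1m x = s"
  unfolding sqrt1m_def using assms by (intro the_equality) (auto intro: sqrt1m_unique_aux)

lemma sqrt1m:
  fixes x :: "'a::unital_cstar_algebra"
  assumes "norm x < 1"
  shows "norm (1 - sqrt1m x) \<le> norm x" "sqrt1m x * sqrt1m x = 1 - x"
    and "z * x = x * z \<Longrightarrow> z * sqrt1m x = sqrt1m x * z"
proof -
  obtain s where s: "norm (1 - s) \<le> norm x" "s * s = 1 - x" "\<forall>z. z * x = x * z \<longrightarrow> z * s = s * z"
    using sqrt1m_exists[OF assms] by blast
  have "sqrt1m x = s" using assms s(1,2) by (intro sqrt1m_eqI) auto
  then show "norm (1 - sqrt1m x) \<le> norm x" "sqrt1m x * sqrt1m x = 1 - x"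
    "z * x = x * z \<Longrightarrow> z * sqrt1m x = sqrt1m x * z"
    using s by blast+
qed

lemma adj_sqrt1m:
  fixes x :: "'a::unital_cstar_algebra"
  assumes "norm x < 1" "adj x = x"
  shows "adj (sqrt1m x) = sqrt1m x"
proof (rule sqrt1m_eqI[symmetric])
  have "norm (1 - adj (sqrt1m x)) = norm (1 - sqrt1m x)"
    by (metis adj_diff adj_one norm_adj)
  then show "norm (1 - adj (sqrt1m x)) < 1" using sqrt1m(1)[OF assms(1)] assms(1) by simp
  show "adj (sqrt1m x) * adj (sqrt1m x) = 1 - x"
    by (metis adj_diff adj_mult adj_one assms sqrt1m(2))
qed

lemma continuous_on_sqrt1m:
  assumes "r < 1"
  shows "continuous_on (cball 0 r) (sqrt1m :: 'a::unital_cstar_algebra \<Rightarrow> 'a)"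
proof (cases "r < 0")
  case False
  have "(1 / (2 * (1 - r)))-lipschitz_on (cball 0 r) (sqrt1m :: 'a \<Rightarrow> 'a)"
  proof (rule lipschitz_onI)
    fix x y :: 'a assume xy: "x \<in> cball 0 r" "y \<in> cball 0 r"
    then have n: "norm x < 1" "norm y < 1" using assms by auto
    have "(1 - r) * norm (sqrt1m x - sqrt1m y)
        \<le> norm (sqrt1m x * sqrt1m x - sqrt1m y * sqrt1m y) / 2"
      using xy sqrt1m(1)[OF n(1)] sqrt1m(1)[OF n(2)] by (intro sqrt1m_Lipschitz_aux) auto
    also have "\<dots> = norm (x - y) / 2"
      by (simp add: sqrt1m(2) n norm_minus_commute)
    finally show "dist (sqrt1m x) (sqrt1m y) \<le> 1 / (2 * (1 - r)) * dist x y"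
      using assms by (simp add: dist_norm field_simps)
  qed (use assms in simp)
  then show ?thesis by (rule lipschitz_on_continuous_on)
qed simp

text \<open>If \<open>1 - a\<^sup>2\<close> were invertible, \<open>1 - a\<^sup>2 - \<eta>\<close> would still be the square of a self-adjoint
  element for small \<open>\<eta> > 0\<close>, which forces \<open>norm a < 1\<close>.\<close>

lemma not_invertible_one_minus_square:
  fixes a :: "'a::unital_cstar_algebra"
  assumes a: "adj a = a" "norm a = 1" and c: "(1 - a * a) * c = 1" "c * (1 - a * a) = 1"
  shows False
proof -
  \<comment> \<open>The factor 8 keeps \<eta> norm c below 1/8. Then 1 + \<eta> c has an inverse
    \<open>e\<close> of norm at most 2, and 2 \<eta> d below has norm less than 1.\<close>
  define \<eta> where "\<eta> = 1 / (8 * (1 + norm c))"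
  have \<eta>: "\<eta> > 0" "\<eta> * norm c < 1 / 8" "\<eta> < 1"
    by (auto simp: \<eta>_def field_simps add_pos_nonneg add_strict_increasing)
  define b where "b = 1 - a * a"
  obtain e where e: "(1 + \<eta> *\<^sub>R c) * e = 1" "e * (1 + \<eta> *\<^sub>R c) = 1"
    using Neumann_inverse[of "1 + \<eta> *\<^sub>R c"] \<eta> by auto
  have "e = 1 - (\<eta> *\<^sub>R c) * e" using e(1) by (simp add: algebra_simps)
  then have "norm e \<le> 1 + norm ((\<eta> *\<^sub>R c) * e)" by (metis norm_one norm_triangle_ineq4)
  also have "\<dots> \<le> 1 + (\<eta> * norm c) * norm e"
    using norm_mult_ineq[of "\<eta> *\<^sub>R c" e] \<eta>(1) by simp
  also have "\<dots> \<le> 1 + (1/8) * norm e"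
    using \<eta>(2) by (intro add_left_mono mult_right_mono) auto
  finally have ne: "norm e \<le> 2" by simp
  \<comment> \<open>\<open>d\<close> is the inverse of b + \<eta>. Since b - \<eta> = (b + \<eta>)
    (1 - 2 \<eta> d), its root is built as the product of roots \<open>s\<close> and
    \<open>g\<close> of the two factors; writing b + \<eta> as (1 + \<eta>) (1 - a^2 / (1 + \<eta>))
    brings \<open>s\<close> within reach of \<open>sqrt1m\<close>.\<close>
  define d where "d = c * e"
  have bc: "b * c = 1" "c * b = 1" using c by (simp_all add: b_def)
  have b\<eta>: "b + \<eta> *\<^sub>R 1 = b * (1 + \<eta> *\<^sub>R c)" "b + \<eta> *\<^sub>R 1 = (1 + \<eta> *\<^sub>R c) * b"
    using bc by (simp_all add: distrib_left distrib_right)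
  have ce: "c * e = e * c"
    by (rule inverse_commutes[OF e]) (simp add: algebra_simps)
  have d: "(b + \<eta> *\<^sub>R 1) * d = 1" "d * (b + \<eta> *\<^sub>R 1) = 1"
    unfolding d_def by (metis b\<eta>(2) bc(1) e(1) mult.assoc mult.right_neutral,
        metis b\<eta>(1) bc(2) ce e(2) mult.assoc mult.right_neutral)
  have "norm ((2 * \<eta>) *\<^sub>R d) \<le> 2 * \<eta> * (norm c * norm e)"
    unfolding d_def using \<eta>(1) norm_mult_ineq[of c e] by simp
  also have "\<dots> \<le> 2 * \<eta> * (norm c * 2)"
    using ne \<eta>(1) by (intro mult_left_mono) auto
  also have "\<dots> < 1" using \<eta>(2) by simp
  finally have nd: "norm ((2 * \<eta>) *\<^sub>R d) < 1" .
  define g where "g = sqrt1m ((2 * \<eta>) *\<^sub>R d)"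
  let ?x = "(1 / (1 + \<eta>)) *\<^sub>R (a * a)"
  have nx: "norm ?x < 1"
    using \<eta>(1) a cstar_identity[of a] by simp
  define s where "s = sqrt (1 + \<eta>) *\<^sub>R sqrt1m ?x"
  have ss: "s * s = b + \<eta> *\<^sub>R 1"
    using \<eta>(1) by (simp add: s_def sqrt1m(2)[OF nx] b_def algebra_simps)
  have gg: "g * g = 1 - (2 * \<eta>) *\<^sub>R d" unfolding g_def by (rule sqrt1m(2)[OF nd])
  have ab: "a * (b + \<eta> *\<^sub>R 1) = (b + \<eta> *\<^sub>R 1) * a" by (simp add: b_def algebra_simps)
  have ad: "a * d = d * a" by (rule inverse_commutes[OF d ab])
  have ag: "a * g = g * a" unfolding g_def by (rule sqrt1m(3)[OF nd]) (simp add: ad)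
  have as: "a * s = s * a" unfolding s_def using sqrt1m(3)[OF nx, of a] by (simp add: algebra_simps)
  have "g * ?x = ?x * g" using ag by (simp add: algebra_simps) (metis mult.assoc)
  then have gs: "g * s = s * g" unfolding s_def using sqrt1m(3)[OF nx, of g] by simp
  have "adj d = d"
  proof -
    have "adj (b + \<eta> *\<^sub>R 1) = b + \<eta> *\<^sub>R 1" using a by (simp add: b_def adj_add adj_diff adj_mult adj_scaleR)
    then have "adj d * (b + \<eta> *\<^sub>R 1) = 1" by (metis adj_mult adj_one d(1))
    then show ?thesis using d(1) by (metis mult.assoc mult.left_neutral mult.right_neutral)
  qed
  then have adjg: "adj g = g" unfolding g_def by (intro adj_sqrt1m[OF nd]) (simp add: adj_scaleR)
  have adjs: "adj s = s" unfolding s_def using adj_sqrt1m[OF nx] a by (simp add: adj_scaleR adj_mult)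
  define k where "k = s * g"
  have "adj k = k" "a * k = k * a"
    using adjg adjs gs ag as by (auto simp: k_def adj_mult mult.assoc) (metis mult.assoc)
  moreover have "k * k = b - \<eta> *\<^sub>R 1"
  proof -
    have "k * k = (s * s) * (g * g)" unfolding k_def using gs by (metis mult.assoc)
    also have "\<dots> = (b + \<eta> *\<^sub>R 1) - (2 * \<eta>) *\<^sub>R ((b + \<eta> *\<^sub>R 1) * d)"
      unfolding ss gg by (simp add: algebra_simps)
    also have "\<dots> = b - \<eta> *\<^sub>R 1" unfolding d by (simp add: scaleR_2[symmetric] algebra_simps)
    finally show ?thesis .
  qed
  then have "a * a + k * k = (1 - \<eta>) *\<^sub>R 1" by (simp add: b_def algebra_simps)
  ultimately have "(norm a)\<^sup>2 \<le> norm ((1 - \<eta>) *\<^sub>R (1::'a))"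
    using norm_square_le_sum_squares[of a k] a by simp
  then show False using a \<eta> by simp
qed

section \<open>Contractivity of *-homomorphisms and polar decomposition of intertwiners\<close>

lemma RepD:
  assumes "\<pi> \<in> Rep"
  shows "\<pi> (x + y) = \<pi> x + \<pi> y" "\<pi> (c *\<^sub>C x) = c *\<^sub>C \<pi> x" "\<pi> (x * y) = \<pi> x * \<pi> y"
    "\<pi> (adj x) = adj (\<pi> x)" "\<pi> 1 = 1"
  using assms by (auto simp: Rep_def)

lemma Rep_zero: "\<pi> \<in> Rep \<Longrightarrow> \<pi> 0 = 0"
  using RepD(1)[of \<pi> 0 0] by simp

lemma Rep_diff: "\<pi> \<in> Rep \<Longrightarrow> \<pi> (x - y) = \<pi> x - \<pi> y"
  using RepD(1)[of \<pi> "x - y" y] by simp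

lemma Rep_sum: "\<pi> \<in> Rep \<Longrightarrow> \<pi> (\<Sum>i\<in>I. f i) = (\<Sum>i\<in>I. \<pi> (f i))"
  by (induction I rule: infinite_finite_induct) (auto simp: RepD Rep_zero)

text \<open>For self-adjoint h of norm below 1 put k = sqrt (1 - h^2). Then \<pi> h and \<pi> k are
  commuting self-adjoint elements whose squares sum to 1, so norm (\<pi> h) is at most 1. Scaling
  handles all self-adjoint elements, and the C*-identity all others.\<close>

lemma norm_Rep_le:
  fixes \<pi> :: "'a::unital_cstar_algebra \<Rightarrow> 'b::unital_cstar_algebra"
  assumes "\<pi> \<in> Rep"
  shows "norm (\<pi> x) \<le> norm x"
proof -
  note R = RepD[OF assms]
  have 1: "norm (\<pi> h) \<le> 1" if "adj h = h" "norm h < 1" for h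
  proof -
    have "norm (h * h) = norm h * norm h"
      using cstar_identity[of h] that(1) by (simp add: power2_eq_square)
    then have n: "norm (h * h) < 1" using that(2) using mult_strict_mono[of "norm h" 1 "norm h" 1] by simp
    define k where "k = sqrt1m (h * h)"
    have "h * k = k * h" unfolding k_def by (rule sqrt1m(3)[OF n]) (simp add: mult.assoc)
    then have "\<pi> h * \<pi> k = \<pi> k * \<pi> h" by (metis R(3))
    moreover have "adj k = k" unfolding k_def using adj_sqrt1m[OF n] that by (simp add: adj_mult)
    then have "adj (\<pi> k) = \<pi> k" by (metis R(4))
    moreover have "adj (\<pi> h) = \<pi> h" by (metis R(4) that(1))
    moreover have "\<pi> h * \<pi> h + \<pi> k * \<pi> k = 1"
      using sqrt1m(2)[OF n] R(1,3,5) by (metis k_def add.commute diff_add_cancel)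
    ultimately have "(norm (\<pi> h))\<^sup>2 \<le> 1"
      using norm_square_le_sum_squares[of "\<pi> h" "\<pi> k"] by simp
    then show ?thesis by (simp add: abs_square_le_1)
  qed
  have R': "\<pi> (r *\<^sub>R y) = r *\<^sub>R \<pi> y" for r y by (simp add: scaleR_cscale R)
  have 2: "norm (\<pi> h) \<le> norm h" if "adj h = h" for h
  proof (rule field_le_epsilon)
    fix e :: real assume "e > 0"
    define r where "r = norm h + e"
    have r: "r > 0" "norm h < r" using \<open>e > 0\<close> by (auto simp: r_def add_nonneg_pos)
    have "norm (\<pi> ((1 / r) *\<^sub>R h)) \<le> 1"
      using r that by (intro 1) (auto simp: adj_scaleR)
    then have "norm (\<pi> h) \<le> r" using r(1) by (simp add: R' divide_le_eq)
    then show "norm (\<pi> h) \<le> norm h + e" by (simp add: r_def)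
  qed
  have "(norm (\<pi> x))\<^sup>2 = norm (\<pi> (adj x * x))" by (simp add: R cstar_identity)
  also have "\<dots> \<le> norm (adj x * x)" by (rule 2) (simp add: adj_mult adj_adj)
  also have "\<dots> = (norm x)\<^sup>2" by (rule cstar_identity)
  finally show ?thesis by (rule power2_le_imp_le) simp
qed

text \<open>The unitary is z times the inverse of the modulus of z. For w = adj U * z the bound 1/3
  gives norm w at most 4/3, hence norm (1 - adj w * w) at most 1/3 + 4/9 < 1, which puts the modulus
  in the domain of \<open>sqrt1m\<close>.\<close>

lemma polar_intertwiner:
  fixes \<pi> \<rho> :: "'a::unital_cstar_algebra \<Rightarrow> 'b::unital_cstar_algebra"
  assumes \<pi>: "\<pi> \<in> Rep" and \<rho>: "\<rho> \<in> Rep"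
    and S: "\<And>a. a \<in> S \<Longrightarrow> adj a \<in> S"
    and z: "\<And>a. a \<in> S \<Longrightarrow> \<pi> a * z = z * \<rho> a"
    and U: "U \<in> unitaries" "norm (z - U) \<le> 1 / 3"
  obtains u where "u \<in> unitaries" "\<And>a. a \<in> S \<Longrightarrow> \<pi> a * u = u * \<rho> a"
proof -
  define w where "w = adj U * z"
  have zw: "z = U * w" using U by (simp add: w_def unitariesD)
  have "norm (1 - w) = norm (U * (1 - w))" using U by (simp add: norm_unitary_mult_left)
  also have "\<dots> = norm (z - U)" by (simp add: zw right_diff_distrib norm_minus_commute)
  finally have nw: "norm (1 - w) \<le> 1 / 3" using U by simp
  obtain w' where w': "w * w' = 1" using Neumann_inverse[of w] nw by auto
  have zz: "adj z * z = adj w * w" using U by (simp add: zw adj_mult mult.assoc unitariesD)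
  have "norm w \<le> 4 / 3"
    using norm_triangle_ineq4[of 1 "1 - w"] nw by simp
  have "1 - adj w * w = (1 - adj w) + adj w * (1 - w)" by (simp add: algebra_simps)
  then have "norm (1 - adj w * w) \<le> norm (1 - adj w) + norm (adj w * (1 - w))"
    by (metis norm_triangle_ineq)
  also have "norm (1 - adj w) = norm (1 - w)" by (metis adj_diff adj_one norm_adj)
  also have "norm (adj w * (1 - w)) \<le> (4 / 3) * (1 / 3)"
    using \<open>norm w \<le> 4 / 3\<close> nw by (intro order_trans[OF norm_mult_ineq] mult_mono) auto
  finally have n: "norm (1 - adj z * z) < 1" using nw zz by simp
  define s where "s = sqrt1m (1 - adj z * z)"
  have s: "s * s = adj z * z" "norm (1 - s) < 1" "adj s = s"
    using sqrt1m(1,2)[OF n] n adj_sqrt1m[OF n]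
    by (auto simp: s_def adj_diff adj_mult adj_adj)
  obtain t where t: "s * t = 1" "t * s = 1" using Neumann_inverse[OF s(2)] by blast
  have adjt: "adj t = t"
    using t s(3) by (metis adj_mult adj_one mult.assoc mult.left_neutral mult.right_neutral)
  define u where "u = z * t"
  have "adj u * u = t * (adj z * z) * t" by (simp add: u_def adj_mult adjt mult.assoc)
  also have "\<dots> = 1" unfolding s(1)[symmetric] by (metis mult.assoc mult.left_neutral t)
  finally have uu: "adj u * u = 1" .
  \<comment> \<open>So far \<open>u\<close> is an isometry. The right inverse \<open>w'\<close> of
    \<open>w\<close> supplies a right inverse of \<open>u\<close>, which must then be
    \<open>adj u\<close>.\<close>
  have "u * (s * (w' * adj U)) = z * ((t * s) * (w' * adj U))" by (simp add: u_def mult.assoc)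
  also have "\<dots> = U * ((w * w') * adj U)" unfolding zw by (simp add: t mult.assoc)
  also have "\<dots> = 1" using U w' by (simp add: unitariesD)
  finally have ur: "u * (s * (w' * adj U)) = 1" .
  then have "adj u = s * (w' * adj U)" using uu by (metis mult.assoc mult.left_neutral mult.right_neutral)
  then have "u \<in> unitaries" using uu ur by (simp add: unitaries_def)
  moreover have "\<pi> a * u = u * \<rho> a" if "a \<in> S" for a
  proof -
    \<comment> \<open>Taking adjoints of the intertwining relation at adj a shows that adj z * z
      commutes with \<rho> a; its root and the inverse of the root inherit this.\<close>
    have "\<pi> (adj a) * z = z * \<rho> (adj a)" using that S z by blast
    then have "adj (adj (\<pi> a) * z) = adj (z * adj (\<rho> a))" by (simp add: RepD \<pi> \<rho>)
    then have "adj z * \<pi> a = \<rho> a * adj z" by (simp add: adj_mult adj_adj)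
    then have "\<rho> a * (adj z * z) = (adj z * z) * \<rho> a" by (metis mult.assoc z[OF that])
    then have "\<rho> a * s = s * \<rho> a"
      unfolding s_def by (intro sqrt1m(3)[OF n]) (simp add: algebra_simps)
    then have "\<rho> a * t = t * \<rho> a" by (rule inverse_commutes[OF t])
    then show ?thesis by (metis u_def mult.assoc z[OF that])
  qed
  ultimately show ?thesis using that by blast
qed

section \<open>Matrix units of finite-dimensional subalgebras\<close>

text \<open>The finite set \<open>F\<close> makes bases of \<open>A\<close> and \<open>B\<close>
  finite, so that their cardinalities really measure dimension. The strict drop drives both the
  choice of minimal right ideals and the induction that splits projections.\<close>

lemma dim_less:
  fixes A B :: "'a::real_vector set"
  assumes "subspace A" "A \<subset> B" "B \<subseteq> span F" "finite F"
  shows "dim A < dim B"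
proof -
  obtain X where X: "X \<subseteq> A" "independent X" "A \<subseteq> span X" "card X = dim A"
    using basis_exists[of A] by blast
  obtain Y where Y: "Y \<subseteq> B" "independent Y" "B \<subseteq> span Y" "card Y = dim B"
    using basis_exists[of B] by blast
  have "X \<subseteq> span F" "Y \<subseteq> span F" using X(1) Y(1) assms(2,3) by auto
  then have fin: "finite X" "finite Y"
    using independent_span_bound[OF \<open>finite F\<close>] X(2) Y(2) by auto
  obtain x where x: "x \<in> B" "x \<notin> A" using assms(2) by blast
  have "span X \<subseteq> A" using X(1) assms(1) by (rule span_minimal)
  then have nx: "x \<notin> span X" using x by blast
  then have "independent (insert x X)" using X(2) by (rule independent_insertI)
  moreover have "insert x X \<subseteq> span Y" using X(1) Y(3) x(1) assms(2) by auto
  ultimately have "card (insert x X) \<le> card Y"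
    using independent_span_bound[OF fin(2)] by blast
  moreover have "x \<notin> X" using nx span_base by blast
  ultimately show ?thesis using fin X Y by simp
qed

locale fd_unital_subalgebra =
  fixes S :: "'a::unital_cstar_algebra set"
  assumes fd: "fd_cstar_subalgebra S" and one_mem: "1 \<in> S"
begin

lemma zero_mem: "0 \<in> S"
  and add_mem: "x \<in> S \<Longrightarrow> y \<in> S \<Longrightarrow> x + y \<in> S"
  and mult_mem: "x \<in> S \<Longrightarrow> y \<in> S \<Longrightarrow> x * y \<in> S"
  and cscale_mem: "x \<in> S \<Longrightarrow> c *\<^sub>C x \<in> S"
  and adj_mem: "x \<in> S \<Longrightarrow> adj x \<in> S"
  using fd unfolding fd_cstar_subalgebra_def by blast+

lemma subspace_S: "subspace S"
  unfolding subspace_def by (simp add: zero_mem add_mem cscale_mem scaleR_cscale)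

lemma diff_mem: "x \<in> S \<Longrightarrow> y \<in> S \<Longrightarrow> x - y \<in> S"
  using subspace_S by (rule subspace_diff)

lemma finite_real_span:
  obtains F where "finite F" "S \<subseteq> span F"
proof -
  obtain F where F: "finite F" "S = cspan F" using fd unfolding fd_cstar_subalgebra_def by blast
  let ?F = "F \<union> (\<lambda>x. \<i> *\<^sub>C x) ` F"
  have "c *\<^sub>C g \<in> span ?F" if "g \<in> F" for c g
  proof -
    have "c *\<^sub>C g = Re c *\<^sub>R g + Im c *\<^sub>R (\<i> *\<^sub>C g)"
      by (simp add: scaleR_cscale cscale_cscale flip: cscale_add_left)
        (metis complex_eq mult.commute)
    also have "\<dots> \<in> span ?F" using that by (intro span_add span_scale span_base) auto
    finally show ?thesis .
  qed
  then have "S \<subseteq> span ?F" unfolding F(2) cspan_def by (auto intro!: span_sum)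
  moreover have "finite ?F" using F(1) by simp
  ultimately show ?thesis using that by blast
qed

text \<open>Real subspaces suffice: as S contains the multiples of 1, closure under right
  multiplication by S includes complex scalars. This lets the real \<open>dim\<close> be used
  throughout.\<close>

definition right_ideal :: "'a set \<Rightarrow> bool" where
  "right_ideal R \<longleftrightarrow> subspace R \<and> R \<subseteq> S \<and> (\<forall>x\<in>R. \<forall>a\<in>S. x * a \<in> R)"

lemma right_ideal_S: "right_ideal S"
  by (simp add: right_ideal_def subspace_S mult_mem)

lemma right_ideal_image:
  assumes "right_ideal R" "a \<in> S"
  shows "right_ideal ((*) a ` R)"
proof -
  have "linear ((*) a)" by (simp add: linear_iff distrib_left)
  then have "subspace ((*) a ` R)"
    using assms linear_subspace_image unfolding right_ideal_def by blast
  then show ?thesis using assms unfolding right_ideal_def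
    by (auto simp: mult.assoc intro!: mult_mem imageI)
qed

lemma right_ideal_annihilator:
  assumes "right_ideal R"
  shows "right_ideal {r \<in> R. a * r = 0}"
  using assms unfolding right_ideal_def subspace_def
  by (auto simp: distrib_left mult.assoc[symmetric])

lemma minimal_right_ideal:
  assumes "right_ideal I" "I \<noteq> {0}"
  obtains R where "right_ideal R" "R \<subseteq> I" "R \<noteq> {0}"
    "\<And>R'. right_ideal R' \<Longrightarrow> R' \<subseteq> R \<Longrightarrow> R' \<noteq> {0} \<Longrightarrow> R' = R"
proof -
  let ?P = "\<lambda>R. right_ideal R \<and> R \<subseteq> I \<and> R \<noteq> {0}"
  obtain F where F: "finite F" "S \<subseteq> span F" by (rule finite_real_span)
  obtain R where R: "?P R" "\<And>R'. ?P R' \<Longrightarrow> dim R \<le> dim R'"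
    using ex_has_least_nat[of ?P I dim] assms by blast
  have "R' = R" if "right_ideal R'" "R' \<subseteq> R" "R' \<noteq> {0}" for R'
  proof (rule ccontr)
    assume "R' \<noteq> R"
    then have "dim R' < dim R"
      using that R(1) F unfolding right_ideal_def by (intro dim_less[of _ _ F]) auto
    then show False using R(1) R(2)[of R'] that by auto
  qed
  then show ?thesis using that R(1) by blast
qed

text \<open>Minimality is expressed by a scalar corner p S p instead of the absence of smaller
  projections, since the scalars are what later become matrix coefficients.\<close>

definition minimal_projection :: "'a \<Rightarrow> bool" where
  "minimal_projection p \<longleftrightarrow>
     p \<in> S \<and> projection p \<and> p \<noteq> 0 \<and> (\<forall>x\<in>S. \<exists>c. p * x * p = c *\<^sub>C p)"

text \<open>In a minimal right ideal R, left multiplication by a self-adjoint h = x adj x in R is a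
  bijection of R, and the preimage of h is the projection p. Minimality makes each nonzero element
  of R generate R; combined with \<open>not_invertible_one_minus_square\<close> this forces
  self-adjoint elements of p S p to be real multiples of p.\<close>

lemma minimal_projection_in_right_ideal:
  assumes "right_ideal I" "I \<noteq> {0}"
  obtains p where "p \<in> I" "minimal_projection p"
proof -
  obtain R where R: "right_ideal R" "R \<subseteq> I" "R \<noteq> {0}"
    and min: "\<And>R'. right_ideal R' \<Longrightarrow> R' \<subseteq> R \<Longrightarrow> R' \<noteq> {0} \<Longrightarrow> R' = R"
    using minimal_right_ideal[OF assms] by blast
  have RS: "R \<subseteq> S" and R0: "0 \<in> R" and Rmult: "\<And>x a. x \<in> R \<Longrightarrow> a \<in> S \<Longrightarrow> x * a \<in> R"
    and Rdiff: "\<And>x y. x \<in> R \<Longrightarrow> y \<in> R \<Longrightarrow> x - y \<in> R"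
    and Radd: "\<And>x y. x \<in> R \<Longrightarrow> y \<in> R \<Longrightarrow> x + y \<in> R"
    using R(1) unfolding right_ideal_def by (auto simp: subspace_0 subspace_diff subspace_add)
  have cyclic: "\<exists>s\<in>S. r = a * s" if "a \<in> R" "a \<noteq> 0" "r \<in> R" for a r
  proof -
    have "a * 1 \<in> (*) a ` S" using one_mem by blast
    then have "(*) a ` S \<noteq> {0}" using that by auto
    moreover have "(*) a ` S \<subseteq> R" using that Rmult by blast
    moreover have "right_ideal ((*) a ` S)" using that RS by (intro right_ideal_image right_ideal_S) auto
    ultimately have "(*) a ` S = R" by (intro min)
    then show ?thesis using that(3) by blast
  qed
  obtain x where x: "x \<in> R" "x \<noteq> 0" using R(3) R0 by blast
  define h where "h = x * adj x"
  have h: "h \<in> R" "adj h = h"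
    using x RS by (auto simp: h_def adj_mult adj_adj intro!: Rmult adj_mem)
  have "h \<noteq> 0" using x adj_mult_self_eq_0_iff[of "adj x"] by (simp add: h_def adj_adj adj_eq_0_iff)
  then have hh: "h * h \<noteq> 0" using h adj_mult_self_eq_0_iff[of h] by simp
  have inj: "r = 0" if "r \<in> R" "h * r = 0" for r
  proof (rule ccontr)
    assume "r \<noteq> 0"
    then have "{r \<in> R. h * r = 0} \<noteq> {0}" using that by blast
    then have "{r \<in> R. h * r = 0} = R" by (intro min right_ideal_annihilator R) auto
    then show False using hh h by blast
  qed
  have "h * h \<in> (*) h ` R" using h by blast
  then have "(*) h ` R \<noteq> {0}" using hh by blast
  then have "(*) h ` R = R" using h RS Rmult by (intro min right_ideal_image R) auto
  then obtain p where p: "p \<in> R" "h * p = h" using h by (metis imageE)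
  have pS: "p \<in> S" using p RS by blast
  \<comment> \<open>Three elements of R are killed by h and hence vanish: p p - p, then p h - h,
    and, after taking the adjoint of p h = h, also p adj p - p. The last makes p
    self-adjoint.\<close>
  have "h * (p * p - p) = 0" using p(2) by (simp add: right_diff_distrib mult.assoc[symmetric])
  then have pp: "p * p = p" using inj[of "p * p - p"] p(1) pS Rdiff Rmult by auto
  have "h * (p * h - h) = 0" using p(2) by (simp add: right_diff_distrib mult.assoc[symmetric])
  then have "p * h = h" using inj[of "p * h - h"] p(1) h RS Rdiff Rmult by auto
  then have "h * adj p = h" using h(2) by (metis adj_mult)
  then have "h * (p * adj p - p) = 0" using p(2) by (simp add: right_diff_distrib mult.assoc[symmetric])
  then have "p * adj p = p" using inj[of "p * adj p - p"] p(1) pS adj_mem Rdiff Rmult by auto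
  then have adjp: "adj p = p" by (metis adj_adj adj_mult)
  have p0: "p \<noteq> 0" using p(2) \<open>h \<noteq> 0\<close> by auto
  have unit: "a = p \<or> a = - p" if a: "a \<in> S" "adj a = a" "p * a = a" "norm a = 1" for a
  proof -
    have ap: "a * p = a" using a adjp by (metis adj_mult)
    have aR: "a \<in> R" using Rmult[OF p(1) a(1)] a(3) by simp
    define z where "z = p - a * a"
    have zR: "z \<in> R" unfolding z_def using p(1) aR a(1) by (intro Rdiff Rmult)
    have pz: "p * z = z" and zp: "z * p = z"
      using a(3) ap pp by (simp_all add: z_def algebra_simps) (metis mult.assoc)
    have adjz: "adj z = z" using a(2) adjp by (simp add: z_def adj_diff adj_mult)
    have "z = 0"
    proof (rule ccontr)
      assume "z \<noteq> 0"
      then obtain s where s: "s \<in> S" "p = z * s" using cyclic zR p(1) by blast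
      \<comment> \<open>If z is nonzero, then p lies in z S, and compressing by p gives an inverse
        of z in the corner. Adding 1 - p to both inverts 1 - a^2, which is impossible for
        self-adjoint a of norm 1.\<close>
      define c where "c = p * s * p"
      have zc: "z * c = p" unfolding c_def by (metis s(2) zp pp mult.assoc)
      have pc: "p * c = c" "c * p = c" unfolding c_def by (metis pp mult.assoc)+
      have "adj c * z = p" using zc adjp adjz by (metis adj_mult)
      then have "adj c = c" using zc pc adjp by (metis adj_mult mult.assoc)
      then have cz: "c * z = p" using \<open>adj c * z = p\<close> by simp
      have eq: "1 - a * a = (1 - p) + z" by (simp add: z_def)
      show False
      proof (rule not_invertible_one_minus_square[of a "(1 - p) + c"])
        show "(1 - a * a) * (1 - p + c) = 1" "(1 - p + c) * (1 - a * a) = 1"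
          unfolding eq using pp zp pz zc cz pc by (simp_all add: algebra_simps)
      qed (use a in auto)
    qed
    then have aa: "a * a = p" by (simp add: z_def)
    show ?thesis
    proof (cases "p + a = 0")
      case True then show ?thesis by (metis add.commute eq_neg_iff_add_eq_0)
    next
      case False
      \<comment> \<open>From a^2 = p follows (p - a)(p + a) = 0. If p + a is nonzero, p is a right
        multiple of it, so p - a annihilates p and a = p.\<close>
      then obtain s where s: "s \<in> S" "p = (p + a) * s" using cyclic p(1) aR Radd by blast
      have "(p - a) * (p + a) = 0" using pp ap a(3) aa by (simp add: algebra_simps)
      then have "(p - a) * p = 0" by (metis s(2) mult.assoc mult_zero_left)
      then show ?thesis using pp ap by (simp add: algebra_simps)
    qed
  qed
  have sa: "\<exists>c. a = c *\<^sub>C p" if a: "a \<in> S" "adj a = a" "p * a = a" for a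
  proof (cases "a = 0")
    case True then show ?thesis by (metis cscale_zero_left)
  next
    case False
    let ?b = "(1 / norm a) *\<^sub>R a"
    have "?b \<in> S" using a(1) by (simp add: scaleR_cscale cscale_mem)
    then have "?b = p \<or> ?b = - p" using a False by (intro unit) (auto simp: adj_scaleR)
    moreover have "a = norm a *\<^sub>R ?b" using False by simp
    ultimately have "a = norm a *\<^sub>R p \<or> a = (- norm a) *\<^sub>R p"
      by (metis scaleR_minus_left scaleR_minus_right)
    then show ?thesis unfolding scaleR_cscale by blast
  qed
  have "\<exists>c. p * y * p = c *\<^sub>C p" if y: "y \<in> S" for y
  proof -
    define u where "u = p * y * p"
    have u: "u \<in> S" "p * u = u" "p * adj u = adj u"
      using y pS pp adjp by (auto simp: u_def adj_mult mult.assoc[symmetric] intro!: mult_mem)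
    have uS: "adj u \<in> S" using u by (simp add: adj_mem)
    obtain c where c: "u + adj u = c *\<^sub>C p"
      using sa[of "u + adj u"] u uS by (auto simp: adj_add adj_adj distrib_left add_mem add.commute)
    obtain d where d: "\<i> *\<^sub>C (u - adj u) = d *\<^sub>C p"
      using sa[of "\<i> *\<^sub>C (u - adj u)"] u uS
      by (auto simp: adj_cscale adj_diff adj_adj mult_cscale_right right_diff_distrib
          cscale_mem diff_mem cscale_minus_left cscale_diff_right)
    have "u - adj u = (- \<i>) *\<^sub>C (d *\<^sub>C p)"
      unfolding d[symmetric] by (simp add: cscale_cscale cscale_one)
    then have "u - adj u = (- \<i> * d) *\<^sub>C p" by (simp add: cscale_cscale)
    moreover have "2 *\<^sub>R u = (u + adj u) + (u - adj u)" by (simp add: scaleR_2)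
    ultimately have "2 *\<^sub>R u = (c - \<i> * d) *\<^sub>C p"
      using c cscale_add_left[of c "- \<i> * d" p] by simp
    then have "(1/2) *\<^sub>R (2 *\<^sub>R u) = (1/2) *\<^sub>R ((c - \<i> * d) *\<^sub>C p)" by simp
    then have "u = (complex_of_real (1/2) * (c - \<i> * d)) *\<^sub>C p"
      by (simp add: scaleR_cscale cscale_cscale cscale_one)
    then show ?thesis unfolding u_def by blast
  qed
  then have "minimal_projection p"
    using pS pp adjp p0 by (simp add: minimal_projection_def projection_def)
  then show ?thesis using that p(1) R(2) by blast
qed

text \<open>Induction on the dimension of the right ideal e S. A minimal projection p in it is split
  off, and f = e - p has a strictly smaller ideal f S, because p f = 0 keeps p out of it.\<close>

lemma decompose_projection:
  assumes "e \<in> S" "projection e"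
  shows "\<exists>Q. finite Q \<and> (\<forall>q\<in>Q. minimal_projection q \<and> e * q = q) \<and>
    (\<forall>q\<in>Q. \<forall>q'\<in>Q. q \<noteq> q' \<longrightarrow> q * q' = 0) \<and> \<Sum>Q = e"
  using assms
proof (induction "dim ((*) e ` S)" arbitrary: e rule: less_induct)
  case less
  note e = less.prems
  show ?case
  proof (cases "e = 0")
    case True
    then show ?thesis by (intro exI[of _ "{}"]) auto
  next
    case False
    have ee: "e * e = e" "adj e = e" using e by (auto simp: projection_def)
    have I: "right_ideal ((*) e ` S)" by (rule right_ideal_image[OF right_ideal_S e(1)])
    have "e * 1 \<in> (*) e ` S" using one_mem by blast
    then have "(*) e ` S \<noteq> {0}" using False by auto
    then obtain p where p: "p \<in> (*) e ` S" "minimal_projection p"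
      using minimal_projection_in_right_ideal[OF I] by blast
    have p': "p \<in> S" "p * p = p" "adj p = p" "p \<noteq> 0"
      using p(2) by (auto simp: minimal_projection_def projection_def)
    have ep: "e * p = p" using p(1) ee by (auto simp: mult.assoc[symmetric])
    then have pe: "p * e = p" using ee p' by (metis adj_mult)
    define f where "f = e - p"
    have f: "f \<in> S" "projection f"
      using e p' ee ep pe by (auto simp: f_def projection_def adj_diff algebra_simps diff_mem)
    have ef: "e * f = f" using ee ep by (simp add: f_def right_diff_distrib)
    have fp: "f * p = 0" using ep p' by (simp add: f_def left_diff_distrib)
    then have pf: "p * f = 0" using f p' by (metis adj_mult adj_zero projection_def)
    have "(*) f ` S \<subseteq> (*) e ` S"
    proof safe
      fix x assume "x \<in> S"
      then have "f * x = e * (f * x)" "f * x \<in> S" using ef f mult_mem by (auto simp: mult.assoc[symmetric])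
      then show "f * x \<in> (*) e ` S" by blast
    qed
    moreover have "p \<notin> (*) f ` S"
    proof
      assume "p \<in> (*) f ` S"
      then obtain x where "p = f * x" by blast
      then have "p * p = 0" using pf by (metis mult.assoc mult_zero_left)
      then show False using p' by simp
    qed
    ultimately have ss: "(*) f ` S \<subset> (*) e ` S" using p(1) by blast
    obtain F where F: "finite F" "S \<subseteq> span F" by (rule finite_real_span)
    have "dim ((*) f ` S) < dim ((*) e ` S)"
      using right_ideal_image[OF right_ideal_S f(1)] I F ss
      by (intro dim_less[of _ _ F]) (auto simp: right_ideal_def)
    then obtain Q where Q: "finite Q" "\<forall>q\<in>Q. minimal_projection q \<and> f * q = q"
        "\<forall>q\<in>Q. \<forall>q'\<in>Q. q \<noteq> q' \<longrightarrow> q * q' = 0" "\<Sum>Q = f"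
      using less.hyps f by blast
    have pq: "p * q = 0 \<and> q * p = 0" if "q \<in> Q" for q
    proof
      have "f * q = q" "adj q = q" using Q(2) that by (auto simp: minimal_projection_def projection_def)
      then show "p * q = 0" by (metis pf mult.assoc mult_zero_left)
      then show "q * p = 0" using \<open>adj q = q\<close> p' by (metis adj_mult adj_zero)
    qed
    then have "p \<notin> Q" using p' by auto
    moreover have "e * q = q" if "q \<in> Q" for q
      using Q(2) that ef by (metis mult.assoc)
    ultimately show ?thesis
      using Q p(2) ep pq by (intro exI[of _ "insert p Q"]) (auto simp: f_def)
  qed
qed

text \<open>Scalar corners turn y = p x q into a multiple of a partial isometry: adj y * y and y *
  adj y are multiples of q and p, with the same real factor as seen from y * adj y * y. What remains
  is the positivity of that factor.\<close>

lemma minimal_projections_equivalent: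
  assumes p: "minimal_projection p" and q: "minimal_projection q" and pq: "p = q \<or> p * q = 0"
    and x: "x \<in> S" "p * x * q \<noteq> 0"
  obtains w where "w \<in> S" "adj w * w = q" "w * adj w = p"
proof (cases "p = q")
  case True
  then show ?thesis using that[of p] p by (auto simp: minimal_projection_def projection_def)
next
  case False
  have P: "p \<in> S" "p * p = p" "adj p = p" "p \<noteq> 0" and Q: "q \<in> S" "q * q = q" "adj q = q" "q \<noteq> 0"
    using p q by (auto simp: minimal_projection_def projection_def)
  have pq0: "p * q = 0" using pq False by blast
  then have qp0: "q * p = 0" using P Q by (metis adj_mult adj_zero)
  define y where "y = p * x * q"
  have y: "y \<in> S" "y \<noteq> 0" using x P Q by (auto simp: y_def mult_mem)
  have py: "p * y = y" and yq: "y * q = y" unfolding y_def by (metis P(2) Q(2) mult.assoc)+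
  have y'p: "adj y * p = adj y" and qy': "q * adj y = adj y"
    using py yq P Q by (metis adj_mult)+
  have "adj y * y = q * (adj y * y) * q" by (metis qy' yq mult.assoc)
  then obtain c where c: "adj y * y = c *\<^sub>C q"
    using q y mult_mem adj_mem unfolding minimal_projection_def by metis
  have "y * adj y = p * (y * adj y) * p" by (metis py y'p mult.assoc)
  then obtain d where d: "y * adj y = d *\<^sub>C p"
    using p y mult_mem adj_mem unfolding minimal_projection_def by metis
  have "adj (adj y * y) = adj y * y" by (simp add: adj_mult adj_adj)
  then have "cnj c *\<^sub>C q = c *\<^sub>C q" unfolding c by (simp add: adj_cscale Q)
  then have "cnj c = c" using Q by (rule_tac cscale_right_cancel)
  then obtain r :: real where r: "c = of_real r" by (metis Reals_cases Reals_cnj_iff)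
  have "y * (adj y * y) = c *\<^sub>C y" unfolding c by (simp add: mult_cscale_right yq)
  moreover have "y * adj y * y = d *\<^sub>C y" unfolding d by (simp add: mult_cscale_left py)
  ultimately have "d = c" using y(2) by (metis mult.assoc cscale_right_cancel)
  have yy: "adj y * y = r *\<^sub>R q" "y * adj y = r *\<^sub>R p"
    using c d r \<open>d = c\<close> by (simp_all add: scaleR_cscale)
  have y_sq: "y * y = 0" by (metis py yq qp0 mult.assoc mult_zero_left mult_zero_right)
  then have y'_sq: "adj y * adj y = 0" by (metis adj_mult adj_zero)
  have "r \<noteq> 0" using yy(1) y(2) adj_mult_self_eq_0_iff[of y] by auto
  have "r > 0"
  proof (rule ccontr)
    assume "\<not> r > 0"
    \<comment> \<open>For r not positive, g = y + adj y and h = m (p + q) commute and g^2 + h^2 = 0.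
      So g + \<i> h = 0 by the C*-identity, and its entry between p and q is y, which would
      vanish.\<close>
    define m where "m = sqrt (- r)"
    have mm: "m * m = - r" using \<open>\<not> r > 0\<close> by (simp add: m_def)
    let ?g = "y + adj y" and ?h = "m *\<^sub>R (p + q)"
    have ye: "adj y * q = 0" "q * y = 0" "p * adj y = 0" "y * p = 0"
      by (metis y'p pq0 mult.assoc mult_zero_right, metis py qp0 mult.assoc mult_zero_left,
          metis qy' pq0 mult.assoc mult_zero_left, metis yq qp0 mult.assoc mult_zero_right)
    have adjs: "adj ?g = ?g" "adj ?h = ?h"
      using P Q by (simp_all add: adj_add adj_adj adj_scaleR add.commute)
    have com: "?g * ?h = ?h * ?g"
      using py yq y'p qy' ye by (simp add: algebra_simps)
    have "adj (?g + \<i> *\<^sub>C ?h) * (?g + \<i> *\<^sub>C ?h) = ?g * ?g + ?h * ?h"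
      by (rule adj_mult_add_ii(1)[OF adjs com])
    also have "?g * ?g = r *\<^sub>R (p + q)"
      using yy y_sq y'_sq by (simp add: algebra_simps)
    also have "?h * ?h = (m * m) *\<^sub>R (p + q)"
      using P Q pq0 qp0 by (simp add: algebra_simps)
    finally have "?g + \<i> *\<^sub>C ?h = 0" by (simp add: mm adj_mult_self_eq_0_iff)
    then have "p * (?g + \<i> *\<^sub>C ?h) * q = 0" by simp
    then have "y = 0" using py yq ye P pq0
      by (simp add: distrib_left distrib_right mult_cscale_right mult_cscale_left)
    then show False using y by simp
  qed
  define w where "w = (1 / sqrt r) *\<^sub>R y"
  have "w \<in> S" using y by (simp add: w_def scaleR_cscale cscale_mem)
  moreover have "adj w * w = q" "w * adj w = p"
    using \<open>r > 0\<close> by (simp_all add: w_def adj_scaleR yy)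
  ultimately show ?thesis using that by blast
qed

text \<open>A family of matrix units in first-column form: \<^term>\<open>v i\<close> is the matrix unit from a chosen minimal
  projection \<^term>\<open>r i\<close> of its block to the \<^term>\<open>i\<close>-th diagonal projection.\<close>

definition matrix_frame :: "'a set \<Rightarrow> ('a \<Rightarrow> 'a) \<Rightarrow> ('a \<Rightarrow> 'a) \<Rightarrow> bool" where
  "matrix_frame Q v r \<longleftrightarrow> finite Q \<and> (\<Sum>i\<in>Q. v i * adj (v i)) = 1 \<and>
    (\<forall>i\<in>Q. v i \<in> S \<and> projection (r i) \<and> adj (v i) * v i = r i \<and> v i * r i = v i) \<and>
    (\<forall>i\<in>Q. \<forall>j\<in>Q. i \<noteq> j \<longrightarrow> adj (v i) * v j = 0) \<and>
    (\<forall>a\<in>S. \<forall>i\<in>Q. \<forall>j\<in>Q. \<exists>c. adj (v i) * a * v j = c *\<^sub>C r i \<and> (r i \<noteq> r j \<longrightarrow> c = 0))"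

lemma matrix_frame_exists: "\<exists>Q v r. matrix_frame Q v r"
proof -
  obtain Q where Q: "finite Q" "\<And>q. q \<in> Q \<Longrightarrow> minimal_projection q"
      "\<And>q q'. q \<in> Q \<Longrightarrow> q' \<in> Q \<Longrightarrow> q \<noteq> q' \<Longrightarrow> q * q' = 0" "\<Sum>Q = 1"
    using decompose_projection[of 1] one_mem by (auto simp: projection_def)
  have proj: "q * q = q" "adj q = q" "q \<noteq> 0" "q \<in> S" if "q \<in> Q" for q
    using Q(2)[OF that] by (auto simp: minimal_projection_def projection_def)
  \<comment> \<open>The relation p S q \<noteq> 0 groups the diagonal projections into blocks. On Q
    it coincides with Murray-von Neumann equivalence, which makes it an equivalence
    relation.\<close>
  define E where "E p q \<longleftrightarrow> (\<exists>x\<in>S. p * x * q \<noteq> 0)" for p q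
  have E_iff: "E p q \<longleftrightarrow> (\<exists>w\<in>S. adj w * w = q \<and> w * adj w = p)" if "p \<in> Q" "q \<in> Q" for p q
  proof
    assume "E p q"
    then show "\<exists>w\<in>S. adj w * w = q \<and> w * adj w = p"
      using minimal_projections_equivalent[of p q] Q that unfolding E_def by metis
  next
    assume "\<exists>w\<in>S. adj w * w = q \<and> w * adj w = p"
    then obtain w where w: "w \<in> S" "adj w * w = q" "w * adj w = p" by blast
    have "adj w * (p * w * q) = (q * q) * q" using w(2,3) by (metis mult.assoc)
    then have "p * w * q \<noteq> 0" using proj[OF that(2)] by auto
    then show "E p q" unfolding E_def using w(1) by blast
  qed
  have E_refl: "E p p" if "p \<in> Q" for p
    using E_iff[OF that that] proj[OF that] by metis
  have E_sym: "E q p" if pq: "p \<in> Q" "q \<in> Q" "E p q" for p q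
  proof -
    obtain w where "w \<in> S" "adj w * w = q" "w * adj w = p" using E_iff pq by blast
    then have "adj w \<in> S \<and> adj (adj w) * adj w = p \<and> adj w * adj (adj w) = q"
      by (simp add: adj_adj adj_mem)
    then show ?thesis using E_iff pq by blast
  qed
  have E_trans: "E p s" if pq: "p \<in> Q" "q \<in> Q" "s \<in> Q" "E p q" "E q s" for p q s
  proof -
    obtain w where w: "w \<in> S" "adj w * w = q" "w * adj w = p" using E_iff pq by blast
    obtain u where u: "u \<in> S" "adj u * u = s" "u * adj u = q" using E_iff pq by blast
    have "adj (w * u) * (w * u) = adj u * q * u" using w(2) by (metis adj_mult mult.assoc)
    also have "\<dots> = s * s" using u by (metis mult.assoc)
    finally have "adj (w * u) * (w * u) = s" using proj that by simp
    moreover have "(w * u) * adj (w * u) = w * q * adj w" using u(3) by (metis adj_mult mult.assoc)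
    then have "(w * u) * adj (w * u) = p * p" using w by (metis mult.assoc)
    then have "(w * u) * adj (w * u) = p" using proj that by simp
    ultimately show ?thesis using E_iff that w u mult_mem by blast
  qed
  \<comment> \<open>Equivalent projections give the same predicate under \<open>SOME\<close>, so
    \<open>r\<close> selects one common representative per block, and \<open>r i = r j\<close> can
    serve as the test for lying in the same block.\<close>
  define r where "r p = (SOME q. q \<in> Q \<and> E p q)" for p
  have r: "r p \<in> Q" "E p (r p)" if "p \<in> Q" for p
    using someI[of "\<lambda>q. q \<in> Q \<and> E p q" p] E_refl that unfolding r_def by blast+
  have r_eq: "r p = r q" if "p \<in> Q" "q \<in> Q" "E (r p) (r q)" for p q
  proof -
    have "E p q" using that r E_sym E_trans by meson
    then have "E p s \<longleftrightarrow> E q s" if "s \<in> Q" for s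
      using E_sym E_trans that \<open>p \<in> Q\<close> \<open>q \<in> Q\<close> by meson
    then show ?thesis unfolding r_def by metis
  qed
  define v where "v p = (SOME w. w \<in> S \<and> adj w * w = r p \<and> w * adj w = p)" for p
  have v: "v p \<in> S" "adj (v p) * v p = r p" "v p * adj (v p) = p" if "p \<in> Q" for p
    using someI_ex[of "\<lambda>w. w \<in> S \<and> adj w * w = r p \<and> w * adj w = p"] E_iff[of p "r p"] r that
    unfolding v_def by blast+
  have vr: "v p * r p = v p" "p * v p = v p" if "p \<in> Q" for p
  proof -
    have vp: "v p * r p = p * v p" using v[OF that] by (metis mult.assoc)
    \<comment> \<open>Expanding this square leaves r - r^2 = 0, so p v = v by the
      C*-identity.\<close>
    have "adj (p * v p - v p) * (p * v p - v p) = adj (v p) * (p * p - p - p + 1) * v p"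
      using proj(2)[OF that] by (simp add: adj_diff adj_mult algebra_simps)
    also have "\<dots> = adj (v p) * v p - adj (v p) * p * v p"
      using proj(1)[OF that] by (simp add: algebra_simps)
    also have "\<dots> = r p - r p * r p" using v[OF that] by (metis mult.assoc)
    also have "\<dots> = 0" using proj[OF r(1)[OF that]] by simp
    finally have "p * v p - v p = 0" by (simp only: adj_mult_self_eq_0_iff)
    then show "v p * r p = v p" "p * v p = v p" using vp by simp_all
  qed
  have "(\<Sum>i\<in>Q. v i * adj (v i)) = 1" using v(3) Q(4) by simp
  moreover have "adj (v i) * v j = 0" if "i \<in> Q" "j \<in> Q" "i \<noteq> j" for i j
  proof -
    have "adj (v i) * i = adj (v i)" using vr(2) proj that by (metis adj_mult)
    then have "adj (v i) * v j = adj (v i) * (i * j) * v j" using vr(2) that by (metis mult.assoc)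
    then show ?thesis using Q(3) that by simp
  qed
  moreover have "\<exists>c. adj (v i) * a * v j = c *\<^sub>C r i \<and> (r i \<noteq> r j \<longrightarrow> c = 0)"
    if "a \<in> S" "i \<in> Q" "j \<in> Q" for a i j
  proof -
    let ?x = "adj (v i) * a * v j"
    have xS: "?x \<in> S" using that v by (intro mult_mem adj_mem)
    have "r i * adj (v i) = adj (v i)" using vr(1) proj r that by (metis adj_mult)
    then have x: "?x = r i * ?x * r j" using vr(1) that by (metis mult.assoc)
    show ?thesis
    proof (cases "r i = r j")
      case True
      then show ?thesis using Q(2)[OF r(1)[OF that(2)]] xS x unfolding minimal_projection_def by metis
    next
      case False
      then have "\<not> E (r i) (r j)" using r_eq that by blast
      then have "?x = 0" using xS x unfolding E_def by metis
      then show ?thesis by (metis cscale_zero_left)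
    qed
  qed
  ultimately have "matrix_frame Q v r"
    unfolding matrix_frame_def using Q(1) v vr proj r by (auto simp: projection_def)
  then show ?thesis by blast
qed

end

section \<open>Unitary equivalence on finite-dimensional subalgebras\<close>

context fd_unital_subalgebra
begin

lemma matrix_frame_coefficients:
  assumes mf: "matrix_frame Q v r" and a: "a \<in> S"
  obtains c where "\<And>j. j \<in> Q \<Longrightarrow> a * v j = (\<Sum>i\<in>Q. c i j *\<^sub>C v i)"
    "\<And>i. i \<in> Q \<Longrightarrow> adj (v i) * a = (\<Sum>j\<in>Q. c i j *\<^sub>C adj (v j))"
    "\<And>i j. i \<in> Q \<Longrightarrow> j \<in> Q \<Longrightarrow> r i \<noteq> r j \<Longrightarrow> c i j = 0"
proof -
  have one: "(\<Sum>i\<in>Q. v i * adj (v i)) = 1" using mf by (simp add: matrix_frame_def)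
  have v: "v i * r i = v i" "adj (r i) = r i" if "i \<in> Q" for i
    using mf that by (auto simp: matrix_frame_def projection_def)
  have v': "r i * adj (v i) = adj (v i)" if "i \<in> Q" for i
    using v[OF that] by (metis adj_mult)
  define c where "c i j = (SOME c. adj (v i) * a * v j = c *\<^sub>C r i \<and> (r i \<noteq> r j \<longrightarrow> c = 0))" for i j
  have c: "adj (v i) * a * v j = c i j *\<^sub>C r i" "r i \<noteq> r j \<Longrightarrow> c i j = 0"
    if "i \<in> Q" "j \<in> Q" for i j
  proof -
    have "\<exists>c. adj (v i) * a * v j = c *\<^sub>C r i \<and> (r i \<noteq> r j \<longrightarrow> c = 0)"
      using mf a that unfolding matrix_frame_def by blast
    from someI_ex[OF this] show "adj (v i) * a * v j = c i j *\<^sub>C r i" "r i \<noteq> r j \<Longrightarrow> c i j = 0"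
      unfolding c_def by blast+
  qed
  have "a * v j = (\<Sum>i\<in>Q. c i j *\<^sub>C v i)" if "j \<in> Q" for j
  proof -
    have "a * v j = (\<Sum>i\<in>Q. v i * adj (v i)) * (a * v j)" by (simp add: one)
    also have "\<dots> = (\<Sum>i\<in>Q. v i * (adj (v i) * a * v j))" by (simp add: sum_distrib_right mult.assoc)
    also have "\<dots> = (\<Sum>i\<in>Q. c i j *\<^sub>C v i)"
      using c(1) v that by (intro sum.cong) (simp_all add: mult_cscale_right)
    finally show ?thesis .
  qed
  moreover have "adj (v i) * a = (\<Sum>j\<in>Q. c i j *\<^sub>C adj (v j))" if "i \<in> Q" for i
  proof -
    have "adj (v i) * a = (adj (v i) * a) * (\<Sum>j\<in>Q. v j * adj (v j))" by (simp add: one)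
    also have "\<dots> = (\<Sum>j\<in>Q. (adj (v i) * a * v j) * adj (v j))" by (simp add: sum_distrib_left mult.assoc)
    also have "\<dots> = (\<Sum>j\<in>Q. c i j *\<^sub>C adj (v j))"
    proof (rule sum.cong)
      fix j assume j: "j \<in> Q"
      show "(adj (v i) * a * v j) * adj (v j) = c i j *\<^sub>C adj (v j)"
        using c[OF that j] v'[OF j] by (cases "r i = r j") (simp_all add: mult_cscale_left)
    qed simp
    finally show ?thesis .
  qed
  ultimately show ?thesis using that c(2) by blast
qed

text \<open>\<open>X\<close> is indexed by \<open>r i\<close>, so it depends only on the block. Both
  sides expand with the same coefficients of a, which vanish across blocks. Constant
  \<open>X\<close> gives the averaging of a unitary; \<pi> = \<rho> with \<open>X\<close> in the
  corners gives elements of the commutant.\<close>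

lemma matrix_frame_intertwines:
  fixes \<pi> \<rho> :: "'a \<Rightarrow> 'b::unital_cstar_algebra" and X :: "'a \<Rightarrow> 'b"
  assumes mf: "matrix_frame Q v r" and a: "a \<in> S" and \<pi>: "\<pi> \<in> Rep" and \<rho>: "\<rho> \<in> Rep"
  defines "z \<equiv> \<Sum>i\<in>Q. \<pi> (v i) * X (r i) * \<rho> (adj (v i))"
  shows "\<pi> a * z = z * \<rho> a"
proof -
  obtain c where c: "\<And>j. j \<in> Q \<Longrightarrow> a * v j = (\<Sum>i\<in>Q. c i j *\<^sub>C v i)"
    "\<And>i. i \<in> Q \<Longrightarrow> adj (v i) * a = (\<Sum>j\<in>Q. c i j *\<^sub>C adj (v j))"
    "\<And>i j. i \<in> Q \<Longrightarrow> j \<in> Q \<Longrightarrow> r i \<noteq> r j \<Longrightarrow> c i j = 0"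
    using matrix_frame_coefficients[OF mf a] by blast
  have "\<pi> a * z = (\<Sum>j\<in>Q. \<pi> (a * v j) * X (r j) * \<rho> (adj (v j)))"
    by (simp add: z_def sum_distrib_left mult.assoc RepD[OF \<pi>])
  also have "\<dots> = (\<Sum>j\<in>Q. \<Sum>i\<in>Q. c i j *\<^sub>C (\<pi> (v i) * X (r j) * \<rho> (adj (v j))))"
    by (simp add: c(1) Rep_sum[OF \<pi>] RepD(2)[OF \<pi>] sum_distrib_right mult_cscale_left)
  also have "\<dots> = (\<Sum>i\<in>Q. \<Sum>j\<in>Q. c i j *\<^sub>C (\<pi> (v i) * X (r j) * \<rho> (adj (v j))))"
    by (rule sum.swap)
  also have "\<dots> = (\<Sum>i\<in>Q. \<Sum>j\<in>Q. c i j *\<^sub>C (\<pi> (v i) * X (r i) * \<rho> (adj (v j))))"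
  proof (intro sum.cong refl)
    fix i j assume "i \<in> Q" "j \<in> Q"
    then show "c i j *\<^sub>C (\<pi> (v i) * X (r j) * \<rho> (adj (v j))) = c i j *\<^sub>C (\<pi> (v i) * X (r i) * \<rho> (adj (v j)))"
      using c(3) by (cases "r i = r j") auto
  qed
  also have "\<dots> = (\<Sum>i\<in>Q. \<pi> (v i) * X (r i) * \<rho> (adj (v i) * a))"
    by (simp add: c(2) Rep_sum[OF \<rho>] RepD(2)[OF \<rho>] sum_distrib_left mult_cscale_right)
  also have "\<dots> = z * \<rho> a"
    by (simp add: z_def sum_distrib_right mult.assoc RepD(3)[OF \<rho>])
  finally show ?thesis .
qed

end

lemma closure_fun_approx:
  fixes A :: "('a \<Rightarrow> 'b::metric_space) set"
  assumes "\<rho> \<in> closure A" "finite F" "e > 0"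
  obtains f where "f \<in> A" "\<And>x. x \<in> F \<Longrightarrow> dist (f x) (\<rho> x) < e"
proof -
  let ?N = "\<Inter>x\<in>F. {f. dist (f x) (\<rho> x) < e}"
  have "open ?N"
    using assms(2)
    by (intro open_INT ballI open_Collect_less continuous_on_dist continuous_on_product_coordinates continuous_on_const)
  moreover have "\<rho> \<in> ?N" using assms(3) by simp
  ultimately have "?N \<inter> A \<noteq> {}" using assms(1) open_Int_closure_eq_empty[of ?N A] by blast
  then show ?thesis using that by blast
qed

lemma (in fd_unital_subalgebra) unitarily_equivalent_on_subalgebra:
  fixes \<pi> \<rho> :: "'a \<Rightarrow> 'b::unital_cstar_algebra"
  assumes \<pi>: "\<pi> \<in> Rep" and \<rho>: "\<rho> \<in> unitary_orbit_closure \<pi>"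
  obtains u where "u \<in> unitaries" "\<And>a. a \<in> S \<Longrightarrow> \<pi> a * u = u * \<rho> a"
proof -
  have \<rho>R: "\<rho> \<in> Rep" and \<rho>c: "\<rho> \<in> closure (unitary_orbit \<pi>)"
    using \<rho> by (auto simp: unitary_orbit_closure_def)
  obtain Q v r where mf: "matrix_frame Q v r" using matrix_frame_exists by blast
  have fin: "finite Q" and one: "(\<Sum>i\<in>Q. v i * adj (v i)) = 1"
    using mf by (auto simp: matrix_frame_def)
  define M where "M = (\<Sum>i\<in>Q. norm (\<pi> (v i)))"
  have M: "M \<ge> 0" unfolding M_def by (simp add: sum_nonneg)
  \<comment> \<open>Chosen so that M e is at most 1/3, the tolerance of
    \<open>polar_intertwiner\<close>; the summand 1 keeps the denominator positive.\<close>
  define e where "e = 1 / (3 * (M + 1))"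
  have e: "e > 0" using M by (simp add: e_def)
  obtain f where f: "f \<in> unitary_orbit \<pi>" "\<And>x. x \<in> (\<lambda>i. adj (v i)) ` Q \<Longrightarrow> dist (f x) (\<rho> x) < e"
    using closure_fun_approx[OF \<rho>c finite_imageI[OF fin] e] by blast
  obtain U where U: "U \<in> unitaries" "f = (\<lambda>a. adj U * \<pi> a * U)"
    using f(1) by (auto simp: unitary_orbit_def)
  define z where "z = (\<Sum>i\<in>Q. \<pi> (v i) * U * \<rho> (adj (v i)))"
  \<comment> \<open>Inserting the resolution of 1 gives U the same shape as z, so their difference
    involves only the finitely many elements adj (v i) at which f was made close to \<rho>.\<close>
  have "U = \<pi> (\<Sum>i\<in>Q. v i * adj (v i)) * U" by (simp add: one RepD(5)[OF \<pi>])
  also have "\<dots> = (\<Sum>i\<in>Q. \<pi> (v i) * (\<pi> (adj (v i)) * U))"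
    by (simp add: Rep_sum[OF \<pi>] RepD(3)[OF \<pi>] sum_distrib_right mult.assoc)
  finally have "z - U = (\<Sum>i\<in>Q. \<pi> (v i) * (U * \<rho> (adj (v i)) - \<pi> (adj (v i)) * U))"
    by (simp add: z_def right_diff_distrib sum_subtractf mult.assoc)
  then have "norm (z - U) \<le> (\<Sum>i\<in>Q. norm (\<pi> (v i) * (U * \<rho> (adj (v i)) - \<pi> (adj (v i)) * U)))"
    by (simp add: norm_sum)
  also have "\<dots> \<le> (\<Sum>i\<in>Q. norm (\<pi> (v i)) * e)"
  proof (rule sum_mono)
    fix i assume i: "i \<in> Q"
    let ?x = "adj (v i)"
    have "norm (U * \<rho> ?x - \<pi> ?x * U) = norm (adj U * (U * \<rho> ?x - \<pi> ?x * U))"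
      by (simp add: norm_unitary_mult_left unitaries_adj U)
    also have "\<dots> = dist (f ?x) (\<rho> ?x)"
      using U by (simp add: dist_norm right_diff_distrib unitariesD mult.assoc norm_minus_commute)
    finally have "norm (U * \<rho> ?x - \<pi> ?x * U) \<le> e" using f(2)[of ?x] i by simp
    then show "norm (\<pi> (v i) * (U * \<rho> ?x - \<pi> ?x * U)) \<le> norm (\<pi> (v i)) * e"
      by (meson mult_left_mono norm_ge_zero norm_mult_ineq order_trans)
  qed
  also have "\<dots> = M * e" by (simp add: M_def sum_distrib_right)
  also have "\<dots> \<le> 1 / 3" using M by (simp add: e_def field_simps)
  finally have "norm (z - U) \<le> 1 / 3" .
  moreover have "\<pi> a * z = z * \<rho> a" if "a \<in> S" for a
    unfolding z_def using matrix_frame_intertwines[OF mf that \<pi> \<rho>R, of "\<lambda>_. U"] .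
  ultimately show ?thesis
    using polar_intertwiner[where S=S and z=z and U=U, OF \<pi> \<rho>R adj_mem] U(1) that by blast
qed

section \<open>Paths of unitaries in corners and commutants\<close>

lemma corner_unitaries_iff:
  assumes "projection P"
  shows "u \<in> corner_unitaries P \<longleftrightarrow> P * u = u \<and> u * P = u \<and> adj u * u = P \<and> u * adj u = P"
proof -
  have PP: "P * P = P" using assms by (simp add: projection_def)
  have "(\<exists>x. u = P * x * P) \<longleftrightarrow> P * u = u \<and> u * P = u"
    using PP by (metis mult.assoc)
  then show ?thesis by (auto simp: corner_unitaries_def)
qed

lemma norm_projection_le_1:
  assumes "projection P"
  shows "norm P \<le> 1"
proof -
  have "norm P * norm P = norm P"
    using assms cstar_identity[of P] by (simp add: projection_def power2_eq_square)
  then show ?thesis by (cases "norm P = 0") auto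
qed

text \<open>Split w = g + \<i> h into real and imaginary parts and follow sqrt (1 - t^2 h^2) + \<i>
  t h. The end point is right because norm (1 - g) < 1 identifies g as the root of 1 - h^2.
  Preserving commutation with projections will keep the path inside a corner.\<close>

lemma path_to_unitary_near_one:
  fixes w :: "'a::unital_cstar_algebra"
  assumes w: "w \<in> unitaries" and near: "norm (w - 1) < 1"
  obtains W :: "real \<Rightarrow> 'a" where "continuous_on {0..1} W" "W 0 = 1" "W 1 = w"
    "\<And>t. t \<in> {0..1} \<Longrightarrow> W t \<in> unitaries"
    "\<And>P t. projection P \<Longrightarrow> P * w = w * P \<Longrightarrow> t \<in> {0..1} \<Longrightarrow> P * W t = W t * P"
proof -
  define g where "g = (1/2) *\<^sub>R (w + adj w)"
  define h where "h = (- \<i> / 2) *\<^sub>C (w - adj w)"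
  have ih: "\<i> *\<^sub>C h = (1/2) *\<^sub>R (w - adj w)"
    by (simp add: h_def cscale_cscale scaleR_cscale)
  have "g + \<i> *\<^sub>C h = (1/2) *\<^sub>R (2 *\<^sub>R w)"
    unfolding ih g_def scaleR_add_right[symmetric] by (simp add: scaleR_2)
  then have w_eq: "w = g + \<i> *\<^sub>C h" by simp
  have adjh: "adj h = h"
    by (simp add: h_def adj_cscale adj_diff adj_adj cscale_minus_left cscale_diff_right)
  have near': "norm (adj w - 1) < 1" using near by (metis adj_diff adj_one norm_adj)
  have "norm h = norm ((w - 1) - (adj w - 1)) / 2"
    by (simp add: h_def norm_cscale norm_divide)
  also have "\<dots> \<le> (norm (w - 1) + norm (adj w - 1)) / 2"
    by (intro divide_right_mono norm_triangle_ineq4) simp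
  finally have nh: "norm h < 1" using near near' by simp
  have "1 - g = (1/2) *\<^sub>R ((1 - w) + (1 - adj w))"
  proof -
    have "(1/2) *\<^sub>R ((1 - w) + (1 - adj w)) = (1/2) *\<^sub>R (2 *\<^sub>R 1) - g"
      unfolding g_def scaleR_right_diff_distrib[symmetric] by (simp add: scaleR_2 algebra_simps)
    then show ?thesis by simp
  qed
  then have "norm (1 - g) \<le> (norm (1 - w) + norm (1 - adj w)) / 2"
    using norm_triangle_ineq[of "1 - w" "1 - adj w"] by simp
  then have ng: "norm (1 - g) < 1" using near near' by (simp add: norm_minus_commute)
  have "h * h = - ((1/4) *\<^sub>R ((w - adj w) * (w - adj w)))"
    by (simp add: h_def mult_cscale_left mult_cscale_right cscale_cscale scaleR_cscale
        cscale_minus_left cscale_minus_right)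
  moreover have "g * g = (1/4) *\<^sub>R ((w + adj w) * (w + adj w))" by (simp add: g_def)
  ultimately have "g * g + h * h = (1/4) *\<^sub>R (((w + adj w) * (w + adj w)) - ((w - adj w) * (w - adj w)))"
    by (simp add: scaleR_right_diff_distrib)
  also have "((w + adj w) * (w + adj w)) - ((w - adj w) * (w - adj w)) = 4 *\<^sub>R 1"
  proof -
    have "((w + adj w) * (w + adj w)) - ((w - adj w) * (w - adj w))
        = 2 *\<^sub>R (w * adj w) + 2 *\<^sub>R (adj w * w)" by (simp add: algebra_simps scaleR_2)
    then show ?thesis using w by (simp add: unitariesD scaleR_left_distrib[symmetric])
  qed
  finally have gh: "g * g + h * h = 1" by simp
  define X where "X t = (t * t) *\<^sub>R (h * h)" for t :: real
  define W where "W t = sqrt1m (X t) + \<i> *\<^sub>C (t *\<^sub>R h)" for t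
  have nhh: "norm (h * h) < 1"
    using cstar_identity[of h] adjh nh by (simp add: power_less_one_iff)
  have nX: "norm (X t) \<le> norm (h * h)" if "t \<in> {0..1}" for t
  proof -
    have "t * t \<le> 1" using that mult_mono[of t 1 t 1] by simp
    then show ?thesis using that mult_right_mono[of "t * t" 1 "norm (h * h)"] by (simp add: X_def)
  qed
  have nX1: "norm (X t) < 1" if "t \<in> {0..1}" for t using nX[OF that] nhh by simp
  have "continuous_on {0..1} (\<lambda>t. sqrt1m (X t))"
  proof (rule continuous_on_compose2[OF continuous_on_sqrt1m[OF nhh]])
    show "continuous_on {0..1} X" unfolding X_def by (intro continuous_intros)
    show "X ` {0..1} \<subseteq> cball 0 (norm (h * h))" using nX by auto
  qed
  moreover have "\<i> *\<^sub>C (t *\<^sub>R h) = t *\<^sub>R (\<i> *\<^sub>C h)" for t :: real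
    by (simp add: scaleR_cscale cscale_cscale mult.commute)
  ultimately have "continuous_on {0..1} W" unfolding W_def by (simp add: continuous_on_add continuous_on_scaleR continuous_on_const continuous_on_id)
  moreover have "sqrt1m (0::'a) = 1" by (rule sqrt1m_eqI) auto
  then have "W 0 = 1" by (simp add: W_def X_def)
  moreover have "sqrt1m (h * h) = g" using ng gh by (intro sqrt1m_eqI) (auto simp: algebra_simps)
  then have "W 1 = w" by (simp add: W_def X_def w_eq)
  moreover have "W t \<in> unitaries" if t: "t \<in> {0..1}" for t
  proof -
    have a: "adj (sqrt1m (X t)) = sqrt1m (X t)"
      by (rule adj_sqrt1m[OF nX1[OF t]]) (simp add: X_def adj_scaleR adj_mult adjh)
    have b: "adj (t *\<^sub>R h) = t *\<^sub>R h" by (simp add: adj_scaleR adjh)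
    have "h * sqrt1m (X t) = sqrt1m (X t) * h"
      by (rule sqrt1m(3)[OF nX1[OF t]]) (simp add: X_def mult.assoc)
    then have c: "sqrt1m (X t) * (t *\<^sub>R h) = (t *\<^sub>R h) * sqrt1m (X t)" by simp
    have "sqrt1m (X t) * sqrt1m (X t) + (t *\<^sub>R h) * (t *\<^sub>R h) = 1"
      by (simp add: sqrt1m(2)[OF nX1[OF t]]) (simp add: X_def)
    then show ?thesis unfolding unitaries_def W_def using adj_mult_add_ii[OF a b c] by simp
  qed
  moreover have "P * W t = W t * P" if P: "projection P" "P * w = w * P" and t: "t \<in> {0..1}" for P t
  proof -
    have "P * adj w = adj w * P" using P by (metis adj_mult projection_def)
    then have Ph: "P * h = h * P"
      using P by (simp add: h_def mult_cscale_left mult_cscale_right algebra_simps)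
    then have "P * (h * h) = h * h * P" by (metis mult.assoc)
    then have "P * X t = X t * P" by (simp add: X_def)
    then have "P * sqrt1m (X t) = sqrt1m (X t) * P" by (rule sqrt1m(3)[OF nX1[OF t]])
    then show ?thesis using Ph
      by (simp add: W_def distrib_left distrib_right mult_cscale_left mult_cscale_right)
  qed
  ultimately show ?thesis by (rule that)
qed

lemma corner_unitaries_path_component_near:
  fixes u v :: "'a::unital_cstar_algebra"
  assumes P: "projection P" and u: "u \<in> corner_unitaries P" and v: "v \<in> corner_unitaries P"
    and near: "norm (v - u) < 1"
  shows "path_component (corner_unitaries P) u v"
proof -
  note U = u[unfolded corner_unitaries_iff[OF P]] and V = v[unfolded corner_unitaries_iff[OF P]]
  have PP: "P * P = P" "adj P = P" using P by (auto simp: projection_def)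
  define x where "x = adj u * v"
  have x: "P * x = x" "x * P = x" "adj x * x = P" "x * adj x = P"
  proof -
    show "P * x = x" unfolding x_def using U PP by (metis adj_mult mult.assoc)
    show "x * P = x" unfolding x_def using V by (metis mult.assoc)
    show "adj x * x = P" unfolding x_def using U V by (metis adj_adj adj_mult mult.assoc)
    show "x * adj x = P" unfolding x_def using U V by (metis adj_adj adj_mult mult.assoc)
  qed
  have x': "P * adj x = adj x" "adj x * P = adj x" using x PP by (metis adj_mult)+
  \<comment> \<open>Adding 1 - P extends the corner unitary adj u * v to a unitary of the whole
    algebra that commutes with P. The path from 1 to it, multiplied on the left by u, returns to the
    corner.\<close>
  define w where "w = x + (1 - P)"
  have w: "w \<in> unitaries"
    using x x' PP by (simp add: w_def unitaries_def adj_add adj_diff algebra_simps)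
  have "w - 1 = adj u * (v - u)" using U by (simp add: w_def x_def right_diff_distrib)
  then have "norm (w - 1) \<le> norm u * norm (v - u)" by (metis norm_adj norm_mult_ineq)
  moreover have "(norm u)\<^sup>2 \<le> 1" using U cstar_identity[of u] norm_projection_le_1[OF P] by simp
  then have "norm u \<le> 1" by (simp add: abs_square_le_1)
  then have "norm u * norm (v - u) \<le> norm (v - u)" by (simp add: mult_left_le_one_le)
  ultimately have nw: "norm (w - 1) < 1" using near by simp
  obtain W :: "real \<Rightarrow> 'a" where W: "continuous_on {0..1} W" "W 0 = 1" "W 1 = w"
      "\<And>t. t \<in> {0..1} \<Longrightarrow> W t \<in> unitaries"
      "\<And>P t. projection P \<Longrightarrow> P * w = w * P \<Longrightarrow> t \<in> {0..1} \<Longrightarrow> P * W t = W t * P"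
    using path_to_unitary_near_one[OF w nw] by blast
  have Pw: "P * w = w * P" using x PP by (simp add: w_def algebra_simps)
  have PW: "P * W t = W t * P" if "t \<in> {0..1}" for t using W(5)[OF P Pw that] .
  have "path (\<lambda>t. u * W t)" unfolding path_def using W(1) by (intro continuous_intros)
  moreover have "path_image (\<lambda>t. u * W t) \<subseteq> corner_unitaries P"
    unfolding path_image_def
  proof (rule image_subsetI)
    fix t :: real assume t: "t \<in> {0..1}"
    note Wt = unitariesD[OF W(4)[OF t]]
    have "P * (u * W t) = u * W t" using U by (metis mult.assoc)
    moreover have "u * W t * P = u * W t" using U PW[OF t] by (metis mult.assoc)
    moreover have "adj (u * W t) * (u * W t) = P"
      using U PW[OF t] Wt by (metis adj_mult mult.assoc mult.right_neutral)
    moreover have "(u * W t) * adj (u * W t) = P"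
      using U Wt by (metis adj_mult mult.assoc mult.right_neutral)
    ultimately show "u * W t \<in> corner_unitaries P" by (simp add: corner_unitaries_iff[OF P])
  qed
  moreover have "u * W 0 = u" using W by simp
  moreover have "u * W 1 = v"
  proof -
    have "u * w = (u * adj u) * v + (u - u * P)" by (simp add: w_def x_def algebra_simps)
    then show ?thesis using U V W by simp
  qed
  ultimately show ?thesis
    unfolding path_component_def pathstart_def pathfinish_def by blast
qed

text \<open>HUC only supplies connectedness. Since the unit ball around each corner unitary meets
  the group inside one path component, path components are relatively open, so there is only
  one.\<close>

lemma corner_unitaries_path_component:
  fixes P :: "'b::unital_cstar_algebra"
  assumes "property_HUC TYPE('b)" and P: "projection P"
    and u: "u \<in> corner_unitaries P" and v: "v \<in> corner_unitaries P"
  shows "path_component (corner_unitaries P) u v"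
proof (rule connected_equivalence_relation[where R="path_component (corner_unitaries P)", OF _ u v])
  show "connected (corner_unitaries P)"
    using assms by (auto simp: property_HUC_def property_UC_corner_def)
next
  fix a assume a: "a \<in> corner_unitaries P"
  have "openin (top_of_set (corner_unitaries P)) (corner_unitaries P \<inter> ball a 1)"
    by (simp add: openin_open_Int)
  moreover have "path_component (corner_unitaries P) a x" if "x \<in> corner_unitaries P \<inter> ball a 1" for x
    using that a by (intro corner_unitaries_path_component_near[OF P]) (auto simp: dist_norm norm_minus_commute)
  ultimately show "\<exists>T. openin (top_of_set (corner_unitaries P)) T \<and> a \<in> T \<and>
      (\<forall>x\<in>T. path_component (corner_unitaries P) a x)"
    using a by (intro exI[of _ "corner_unitaries P \<inter> ball a 1"]) auto
qed (auto intro: path_component_sym path_component_trans)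

lemma (in fd_unital_subalgebra) commutant_unitary_path:
  fixes \<pi> :: "'a \<Rightarrow> 'b::unital_cstar_algebra"
  assumes huc: "property_HUC TYPE('b)" and \<pi>: "\<pi> \<in> Rep" and w: "w \<in> unitaries"
    and comm: "\<And>a. a \<in> S \<Longrightarrow> \<pi> a * w = w * \<pi> a"
  obtains g :: "real \<Rightarrow> 'b" where "continuous_on {0..1} g" "g 0 = 1" "g 1 = w"
    "\<And>t. t \<in> {0..1} \<Longrightarrow> g t \<in> unitaries"
    "\<And>a t. t \<in> {0..1} \<Longrightarrow> a \<in> S \<Longrightarrow> \<pi> a * g t = g t * \<pi> a"
proof -
  note R = RepD[OF \<pi>]
  obtain Q v r where mf: "matrix_frame Q v r" using matrix_frame_exists by blast
  have fin: "finite Q" and one: "(\<Sum>i\<in>Q. v i * adj (v i)) = 1"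
    and v: "\<And>i. i \<in> Q \<Longrightarrow> v i \<in> S" "\<And>i. i \<in> Q \<Longrightarrow> adj (v i) * v i = r i" "\<And>i. i \<in> Q \<Longrightarrow> v i * r i = v i"
      "\<And>i. i \<in> Q \<Longrightarrow> projection (r i)"
    and orth: "\<And>i j. i \<in> Q \<Longrightarrow> j \<in> Q \<Longrightarrow> i \<noteq> j \<Longrightarrow> adj (v i) * v j = 0"
    using mf by (auto simp: matrix_frame_def)
  have rS: "r i \<in> S" if "i \<in> Q" for i using v(1,2)[OF that] by (metis adj_mem mult_mem)
  have pr: "projection (\<pi> (r i))" if "i \<in> Q" for i
    using v(4)[OF that] by (simp add: projection_def flip: R)
  have "\<exists>\<gamma>. continuous_on {0..1} \<gamma> \<and> \<gamma> 0 = \<pi> q \<and> \<gamma> 1 = \<pi> q * w \<and>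
      (\<forall>t\<in>{0..1::real}. \<gamma> t \<in> corner_unitaries (\<pi> q))" if "q \<in> r ` Q" for q
  proof -
    have q: "projection (\<pi> q)" "\<pi> q * w = w * \<pi> q" using that pr rS comm by auto
    have qq: "\<pi> q * \<pi> q = \<pi> q" "adj (\<pi> q) = \<pi> q" using q by (auto simp: projection_def)
    have "\<pi> q \<in> corner_unitaries (\<pi> q)" using qq by (simp add: corner_unitaries_iff[OF q(1)])
    moreover have "\<pi> q * w \<in> corner_unitaries (\<pi> q)"
      unfolding corner_unitaries_iff[OF q(1)]
    proof (intro conjI)
      show "\<pi> q * (\<pi> q * w) = \<pi> q * w" using qq by (metis mult.assoc)
      show "\<pi> q * w * \<pi> q = \<pi> q * w" using qq q(2) by (metis mult.assoc)
      show "adj (\<pi> q * w) * (\<pi> q * w) = \<pi> q"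
        using qq q(2) unitariesD(1)[OF w] by (metis adj_mult mult.assoc mult.left_neutral)
      show "\<pi> q * w * adj (\<pi> q * w) = \<pi> q"
        using qq q(2) unitariesD(2)[OF w] by (metis adj_mult mult.assoc mult.right_neutral)
    qed
    ultimately have "path_component (corner_unitaries (\<pi> q)) (\<pi> q) (\<pi> q * w)"
      by (rule corner_unitaries_path_component[OF huc q(1)])
    then show ?thesis
      unfolding path_component_def path_def path_image_def pathstart_def pathfinish_def by blast
  qed
  then obtain \<gamma> where \<gamma>: "\<And>q. q \<in> r ` Q \<Longrightarrow> continuous_on {0..1::real} (\<gamma> q)" "\<And>q. q \<in> r ` Q \<Longrightarrow> \<gamma> q 0 = \<pi> q"
      "\<And>q. q \<in> r ` Q \<Longrightarrow> \<gamma> q 1 = \<pi> q * w" "\<And>q t. q \<in> r ` Q \<Longrightarrow> t \<in> {0..1} \<Longrightarrow> \<gamma> q t \<in> corner_unitaries (\<pi> q)"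
    by metis
  define g where "g t = (\<Sum>i\<in>Q. \<pi> (v i) * \<gamma> (r i) t * \<pi> (adj (v i)))" for t
  have \<pi>one: "(\<Sum>i\<in>Q. \<pi> (v i) * \<pi> (adj (v i))) = 1"
    using arg_cong[OF one, of \<pi>] by (simp only: Rep_sum[OF \<pi>] R(3,5))
  have vr: "\<pi> (v i) * \<pi> (r i) = \<pi> (v i)" if "i \<in> Q" for i using v(3)[OF that] by (simp flip: R)
  \<comment> \<open>Orthogonality of the \<open>v i\<close> removes the cross terms, so these sums
    multiply blockwise. Both unitarity equations for \<open>g t\<close> are instances.\<close>
  have mult: "(\<Sum>i\<in>Q. \<pi> (v i) * X i * \<pi> (adj (v i))) * (\<Sum>i\<in>Q. \<pi> (v i) * Y i * \<pi> (adj (v i)))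
      = 1" if XY: "\<And>i. i \<in> Q \<Longrightarrow> X i * \<pi> (r i) * Y i = \<pi> (r i)" for X Y
  proof -
    have "\<pi> (v i) * X i * \<pi> (adj (v i)) * (\<Sum>j\<in>Q. \<pi> (v j) * Y j * \<pi> (adj (v j)))
        = \<pi> (v i) * \<pi> (adj (v i))" if i: "i \<in> Q" for i
    proof -
      have "\<pi> (v i) * X i * \<pi> (adj (v i)) * (\<Sum>j\<in>Q. \<pi> (v j) * Y j * \<pi> (adj (v j)))
          = (\<Sum>j\<in>Q. \<pi> (v i) * X i * \<pi> (adj (v i) * v j) * (Y j * \<pi> (adj (v j))))"
        by (simp add: sum_distrib_left mult.assoc R(3))
      also have "\<dots> = (\<Sum>j\<in>Q. if j = i then \<pi> (v i) * X i * \<pi> (r i) * (Y i * \<pi> (adj (v i))) else 0)"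
        using i orth v(2) by (intro sum.cong) (auto simp: Rep_zero[OF \<pi>])
      also have "\<dots> = \<pi> (v i) * (X i * \<pi> (r i) * Y i) * \<pi> (adj (v i))"
        using fin i by (simp add: mult.assoc)
      finally show ?thesis using XY[OF i] vr[OF i] by simp
    qed
    then show ?thesis by (simp add: sum_distrib_right \<pi>one)
  qed
  have "continuous_on {0..1} g" unfolding g_def using \<gamma>(1) by (intro continuous_intros) auto
  moreover have "g 0 = 1" by (simp add: g_def \<gamma>(2) vr \<pi>one)
  moreover have "g 1 = w"
  proof -
    have "\<pi> (v i) * \<gamma> (r i) 1 * \<pi> (adj (v i)) = \<pi> (v i) * \<pi> (adj (v i)) * w" if i: "i \<in> Q" for i
    proof -
      have "\<pi> (v i) * \<gamma> (r i) 1 = \<pi> (v i) * w" using vr[OF i] i by (simp add: \<gamma>(3) mult.assoc[symmetric])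
      then show ?thesis using comm[OF adj_mem[OF v(1)[OF i]]] by (simp add: mult.assoc)
    qed
    then have "g 1 = (\<Sum>i\<in>Q. \<pi> (v i) * \<pi> (adj (v i))) * w" by (simp add: g_def sum_distrib_right)
    then show ?thesis by (simp add: \<pi>one)
  qed
  moreover have "g t \<in> unitaries" if t: "t \<in> {0..1}" for t
  proof -
    have adjg: "adj (g t) = (\<Sum>i\<in>Q. \<pi> (v i) * adj (\<gamma> (r i) t) * \<pi> (adj (v i)))"
      by (simp add: g_def adj_sum adj_mult R(4) adj_adj mult.assoc)
    have C: "\<pi> (r i) * \<gamma> (r i) t = \<gamma> (r i) t \<and> \<gamma> (r i) t * \<pi> (r i) = \<gamma> (r i) t \<and>
        adj (\<gamma> (r i) t) * \<gamma> (r i) t = \<pi> (r i) \<and> \<gamma> (r i) t * adj (\<gamma> (r i) t) = \<pi> (r i)" if "i \<in> Q" for i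
      using \<gamma>(4)[of "r i" t] t that corner_unitaries_iff[OF pr[OF that]] by blast
    have "adj (g t) * g t = 1" unfolding adjg unfolding g_def using C by (intro mult) (simp add: mult.assoc)
    moreover have "g t * adj (g t) = 1" unfolding adjg unfolding g_def using C by (intro mult) simp
    ultimately show ?thesis by (simp add: unitaries_def)
  qed
  moreover have "\<pi> a * g t = g t * \<pi> a" if "t \<in> {0..1}" "a \<in> S" for a t
    unfolding g_def using matrix_frame_intertwines[OF mf that(2) \<pi> \<pi>, of "\<lambda>q. \<gamma> q t"] .
  ultimately show ?thesis by (rule that)
qed

section \<open>Concatenating the paths\<close>

lemma fd_unital_subalgebra_unitization:
  fixes S :: "'a::unital_cstar_algebra set"
  assumes S: "fd_cstar_subalgebra S"
  shows "fd_unital_subalgebra {x + c *\<^sub>C 1 | x c. x \<in> S}" (is "fd_unital_subalgebra ?T")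
proof
  have S0: "0 \<in> S" and Sadd: "\<And>x y. x \<in> S \<Longrightarrow> y \<in> S \<Longrightarrow> x + y \<in> S"
    and Smult: "\<And>x y. x \<in> S \<Longrightarrow> y \<in> S \<Longrightarrow> x * y \<in> S"
    and Scscale: "\<And>c x. x \<in> S \<Longrightarrow> c *\<^sub>C x \<in> S" and Sadj: "\<And>x. x \<in> S \<Longrightarrow> adj x \<in> S"
    using S unfolding fd_cstar_subalgebra_def by blast+
  obtain F where F: "finite F" "S = cspan F" using S unfolding fd_cstar_subalgebra_def by blast
  have TI: "x + c *\<^sub>C 1 \<in> ?T" if "x \<in> S" for x c using that by blast
  have "0 + 1 *\<^sub>C 1 \<in> ?T" "0 + 0 *\<^sub>C 1 \<in> ?T" using S0 TI by blast+
  then show "1 \<in> ?T" by (simp add: cscale_one)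
  have "0 \<in> ?T" using \<open>0 + 0 *\<^sub>C 1 \<in> ?T\<close> by simp
  moreover have "\<forall>a\<in>?T. \<forall>b\<in>?T. a + b \<in> ?T \<and> a * b \<in> ?T"
  proof (intro ballI)
    fix a b assume "a \<in> ?T" "b \<in> ?T"
    then obtain x c y d where ab: "a = x + c *\<^sub>C 1" "b = y + d *\<^sub>C 1" and xy: "x \<in> S" "y \<in> S" by blast
    have "a + b = (x + y) + (c + d) *\<^sub>C 1" by (simp add: ab cscale_add_left)
    moreover have "a * b = (x * y + (c *\<^sub>C y + d *\<^sub>C x)) + (c * d) *\<^sub>C 1"
      by (simp add: ab distrib_left distrib_right mult_cscale_left mult_cscale_right cscale_cscale
          cscale_add_right mult.commute)
    moreover have "(x + y) + (c + d) *\<^sub>C 1 \<in> ?T" using xy Sadd by (intro TI)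
    moreover have "(x * y + (c *\<^sub>C y + d *\<^sub>C x)) + (c * d) *\<^sub>C 1 \<in> ?T"
      using xy by (intro TI Sadd Smult Scscale)
    ultimately show "a + b \<in> ?T \<and> a * b \<in> ?T" by simp
  qed
  moreover have "\<forall>e. \<forall>a\<in>?T. e *\<^sub>C a \<in> ?T"
  proof (intro allI ballI)
    fix e a assume "a \<in> ?T"
    then obtain x c where a: "a = x + c *\<^sub>C 1" "x \<in> S" by blast
    then have "e *\<^sub>C a = e *\<^sub>C x + (e * c) *\<^sub>C 1" by (simp add: cscale_add_right cscale_cscale)
    then show "e *\<^sub>C a \<in> ?T" using TI[OF Scscale[OF a(2)]] by simp
  qed
  moreover have "\<forall>a\<in>?T. adj a \<in> ?T"
  proof
    fix a assume "a \<in> ?T"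
    then obtain x c where a: "a = x + c *\<^sub>C 1" "x \<in> S" by blast
    then have "adj a = adj x + cnj c *\<^sub>C 1" by (simp add: adj_add adj_cscale)
    then show "adj a \<in> ?T" using TI[OF Sadj[OF a(2)]] by simp
  qed
  moreover have "?T = cspan (insert 1 F)"
  proof (intro equalityI subsetI)
    fix a assume "a \<in> ?T"
    then obtain x d where a: "a = x + d *\<^sub>C 1" "x \<in> S" by blast
    then obtain G c where G: "finite G" "G \<subseteq> F" "x = (\<Sum>g\<in>G. c g *\<^sub>C g)"
      unfolding F(2) cspan_def by blast
    \<comment> \<open>The element 1 may already occur in \<open>G\<close>, so its old coefficient
      and the new scalar d are added rather than one replacing the other.\<close>
    define c' where "c' g = (if g \<in> G then c g else 0) + (if g = 1 then d else 0)" for g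
    have "(\<Sum>g\<in>insert 1 G. c' g *\<^sub>C g)
        = (\<Sum>g\<in>insert 1 G. (if g \<in> G then c g else 0) *\<^sub>C g) + (\<Sum>g\<in>insert 1 G. (if g = 1 then d else 0) *\<^sub>C g)"
      by (simp only: c'_def cscale_add_left sum.distrib)
    also have "(\<Sum>g\<in>insert 1 G. (if g \<in> G then c g else 0) *\<^sub>C g) = x"
      unfolding G(3) using G(1) by (intro sum.mono_neutral_cong_right) auto
    also have "(\<Sum>g\<in>insert 1 G. (if g = 1 then d else 0) *\<^sub>C g) = (\<Sum>g\<in>{1}. d *\<^sub>C g)"
      using G(1) by (intro sum.mono_neutral_cong_right) auto
    finally have "a = (\<Sum>g\<in>insert 1 G. c' g *\<^sub>C g)" using a by simp
    then show "a \<in> cspan (insert 1 F)" using G(1,2)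
      unfolding cspan_def by (intro CollectI exI[of _ "insert 1 G"] exI[of _ c']) auto
  next
    fix a assume "a \<in> cspan (insert 1 F)"
    then obtain G c where G: "finite G" "G \<subseteq> insert 1 F" "a = (\<Sum>g\<in>G. c g *\<^sub>C g)"
      unfolding cspan_def by blast
    define d where "d = (if 1 \<in> G then c 1 else 0)"
    have "a = (\<Sum>g\<in>G - {1}. c g *\<^sub>C g) + d *\<^sub>C 1"
      using G(1) unfolding G(3) d_def by (auto simp: sum.remove add.commute)
    moreover have "(\<Sum>g\<in>G - {1}. c g *\<^sub>C g) \<in> S"
      unfolding F(2) cspan_def using G by (intro CollectI exI[of _ "G - {1}"] exI[of _ c]) auto
    ultimately show "a \<in> ?T" using TI by simp
  qed
  then have "\<exists>F. finite F \<and> ?T = cspan F" using F(1) by (intro exI[of _ "insert 1 F"]) auto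
  ultimately show "fd_cstar_subalgebra ?T" unfolding fd_cstar_subalgebra_def by (intro conjI)
qed

lemma AF_alg_unital_chain:
  assumes "AF_alg TYPE('a)"
  obtains T :: "nat \<Rightarrow> 'a::unital_cstar_algebra set" where "\<And>n. fd_unital_subalgebra (T n)" "\<And>n. T n \<subseteq> T (Suc n)"
    "T 0 = range (\<lambda>c. c *\<^sub>C 1)" "closure (\<Union>n. T n) = UNIV"
proof -
  obtain S :: "nat \<Rightarrow> 'a set" where S: "\<And>n. fd_cstar_subalgebra (S n)" "\<And>n. S n \<subseteq> S (Suc n)"
      "closure (\<Union>n. S n) = UNIV"
    using assms unfolding AF_alg_def by blast
  have z: "fd_cstar_subalgebra {0::'a}"
    unfolding fd_cstar_subalgebra_def cspan_def by (auto intro!: exI[of _ "{}"])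
  \<comment> \<open>The index is shifted by one: level 0 comes from the zero subalgebra and yields
    the scalars, and \<open>S m\<close> is absorbed in level m + 1.\<close>
  define T where "T n = {x + c *\<^sub>C 1 | x c. x \<in> (case n of 0 \<Rightarrow> {0} | Suc m \<Rightarrow> S m)}" for n
  have "fd_unital_subalgebra (T n)" for n
    unfolding T_def by (rule fd_unital_subalgebra_unitization) (simp add: z S split: nat.split)
  moreover have "0 \<in> S n" for n using S(1)[of n] by (simp add: fd_cstar_subalgebra_def)
  then have "T n \<subseteq> T (Suc n)" for n
    unfolding T_def using S(2) by (cases n) force+
  moreover have "T 0 = range (\<lambda>c. c *\<^sub>C 1)" by (auto simp: T_def)
  moreover have "S n \<subseteq> T (Suc n)" for n
  proof
    fix x assume "x \<in> S n"
    then have "x + 0 *\<^sub>C 1 \<in> T (Suc n)" unfolding T_def nat.case by blast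
    then show "x \<in> T (Suc n)" by simp
  qed
  then have "(\<Union>n. S n) \<subseteq> (\<Union>n. T n)" by blast
  then have "closure (\<Union>n. T n) = UNIV" using S(3) closure_mono by blast
  ultimately show ?thesis by (rule that)
qed

lemma continuous_on_concatenation:
  fixes g :: "nat \<Rightarrow> real \<Rightarrow> 'a::topological_space"
  assumes cont: "\<And>n. continuous_on {0..1} (g n)" and match: "\<And>n. g n 1 = g (Suc n) 0"
  defines "u \<equiv> \<lambda>s. g (nat \<lfloor>s\<rfloor>) (s - real (nat \<lfloor>s\<rfloor>))"
  shows "continuous_on {0..real n} u"
proof (induction n)
  case (Suc n)
  \<comment> \<open>At the right end s = n + 1 the floor already selects piece n + 1 at parameter 0;
    \<open>match\<close> identifies this with piece n at 1.\<close>
  have u: "u s = g n (s - real n)" if "s \<in> {real n..real (Suc n)}" for s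
  proof (cases "s = real (Suc n)")
    case True
    then have "nat \<lfloor>s\<rfloor> = Suc n" by (simp add: nat_eq_iff)
    then have "u s = g (Suc n) 0" using True by (simp add: u_def)
    then show ?thesis using match True by simp
  next
    case False
    then have "\<lfloor>s\<rfloor> = int n" using that by (intro floor_unique) auto
    then show ?thesis by (simp add: u_def)
  qed
  have "continuous_on {real n..real (Suc n)} (\<lambda>s. g n (s - real n))"
    by (rule continuous_on_compose2[OF cont]) (auto intro!: continuous_intros)
  then have "continuous_on {real n..real (Suc n)} u"
    by (rule continuous_on_eq) (simp add: u)
  with Suc have "continuous_on ({0..real n} \<union> {real n..real (Suc n)}) u"
    by (intro continuous_on_closed_Un) auto
  moreover have "{0..real n} \<union> {real n..real (Suc n)} = {0..real (Suc n)}" by auto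
  ultimately show ?case by simp
qed simp

lemma conjugate_Rep:
  assumes \<pi>: "\<pi> \<in> Rep" and u: "u \<in> unitaries"
  shows "(\<lambda>a. adj u * \<pi> a * u) \<in> Rep"
proof -
  have "adj u * (\<pi> x * \<pi> y) * u = (adj u * \<pi> x * u) * (adj u * \<pi> y * u)" for x y
    using u by (simp add: mult.assoc unitariesD)
  then show ?thesis
    using u by (simp add: Rep_def RepD[OF \<pi>] unitariesD distrib_left distrib_right mult_cscale_left
        mult_cscale_right adj_mult adj_adj mult.assoc)
qed

lemma unitary_orbit_closure_conjugate:
  assumes "\<pi> \<in> Rep" "u \<in> unitaries"
  shows "(\<lambda>a. adj u * \<pi> a * u) \<in> unitary_orbit_closure \<pi>"
proof -
  have "(\<lambda>a. adj u * \<pi> a * u) \<in> unitary_orbit \<pi>" using assms(2) unfolding unitary_orbit_def by blast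
  then show ?thesis
    using conjugate_Rep[OF assms] closure_subset[of "unitary_orbit \<pi>"]
    unfolding unitary_orbit_closure_def by blast
qed

lemma intertwining_unitary_paths:
  fixes \<pi> \<rho> :: "'a::unital_cstar_algebra \<Rightarrow> 'b::unital_cstar_algebra"
  assumes huc: "property_HUC TYPE('b)" and \<pi>: "\<pi> \<in> Rep" and \<rho>: "\<rho> \<in> unitary_orbit_closure \<pi>"
    and T: "\<And>n. fd_unital_subalgebra (T n)" "\<And>n. T n \<subseteq> T (Suc n)" and T0: "T 0 = range (\<lambda>c. c *\<^sub>C 1)"
  obtains g :: "nat \<Rightarrow> real \<Rightarrow> 'b" where "\<And>n. continuous_on {0..1} (g n)" "g 0 0 = 1"
    "\<And>n. g n 1 = g (Suc n) 0" "\<And>n t. t \<in> {0..1} \<Longrightarrow> g n t \<in> unitaries"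
    "\<And>n t a. t \<in> {0..1} \<Longrightarrow> a \<in> T n \<Longrightarrow> \<pi> a * g n t = g n t * \<rho> a"
proof -
  have \<rho>R: "\<rho> \<in> Rep" using \<rho> by (simp add: unitary_orbit_closure_def)
  have "\<exists>u\<in>unitaries. (\<forall>a\<in>T n. \<pi> a * u = u * \<rho> a) \<and> (n = 0 \<longrightarrow> u = 1)" for n
  proof (cases "n = 0")
    case True
    have "\<pi> a * 1 = 1 * \<rho> a" if "a \<in> T 0" for a
      using that T0 by (auto simp: RepD[OF \<pi>] RepD[OF \<rho>R])
    then show ?thesis using True by (intro bexI[of _ 1]) auto
  next
    case False
    obtain u where "u \<in> unitaries" "\<And>a. a \<in> T n \<Longrightarrow> \<pi> a * u = u * \<rho> a"
      by (rule fd_unital_subalgebra.unitarily_equivalent_on_subalgebra[OF T(1)[of n] \<pi> \<rho>]) blast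
    then show ?thesis using False by blast
  qed
  then obtain U where U: "\<And>n. U n \<in> unitaries" "\<And>n a. a \<in> T n \<Longrightarrow> \<pi> a * U n = U n * \<rho> a" "U 0 = 1"
    by metis
  have "\<exists>k. continuous_on {0..1::real} k \<and> k 0 = 1 \<and> k 1 = U (Suc n) * adj (U n) \<and>
      (\<forall>t\<in>{0..1}. k t \<in> unitaries \<and> (\<forall>a\<in>T n. \<pi> a * k t = k t * \<pi> a))" for n
  proof -
    let ?w = "U (Suc n) * adj (U n)"
    have w: "?w \<in> unitaries" using U(1) by (intro unitaries_mult unitaries_adj)
    have comm: "\<pi> a * ?w = ?w * \<pi> a" if a: "a \<in> T n" for a
    proof -
      have "\<rho> a * adj (U n) = adj (U n) * (U n * \<rho> a) * adj (U n)"
        by (simp add: unitariesD[OF U(1)])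
      also have "\<dots> = adj (U n) * \<pi> a"
        unfolding U(2)[OF a, symmetric] by (simp add: mult.assoc unitariesD[OF U(1)])
      finally have "\<rho> a * adj (U n) = adj (U n) * \<pi> a" .
      moreover have "\<pi> a * U (Suc n) = U (Suc n) * \<rho> a" using U(2) a T(2) by blast
      ultimately show ?thesis by (metis mult.assoc)
    qed
    obtain k :: "real \<Rightarrow> 'b" where "continuous_on {0..1} k" "k 0 = 1" "k 1 = ?w"
        "\<And>t. t \<in> {0..1} \<Longrightarrow> k t \<in> unitaries"
        "\<And>a t. t \<in> {0..1} \<Longrightarrow> a \<in> T n \<Longrightarrow> \<pi> a * k t = k t * \<pi> a"
      by (rule fd_unital_subalgebra.commutant_unitary_path[OF T(1)[of n] huc \<pi> w comm], assumption)
        (rule that; blast)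
    then show ?thesis by blast
  qed
  then obtain k where k: "\<And>n. continuous_on {0..1::real} (k n)" "\<And>n. k n 0 = 1"
      "\<And>n. k n 1 = U (Suc n) * adj (U n)" "\<And>n t. t \<in> {0..1} \<Longrightarrow> k n t \<in> unitaries"
      "\<And>n t a. t \<in> {0..1} \<Longrightarrow> a \<in> T n \<Longrightarrow> \<pi> a * k n t = k n t * \<pi> a"
    by metis
  show ?thesis
  \<comment> \<open>Multiplying the commutant path by U n on the right gives a path from U n to U (n
    + 1), each point of which still intertwines \<pi> and \<rho> on \<open>T n\<close>.\<close>
  proof (rule that[of "\<lambda>n t. k n t * U n"])
    show "continuous_on {0..1} (\<lambda>t. k n t * U n)" for n using k(1) by (intro continuous_intros)
    show "k 0 0 * U 0 = 1" by (simp add: k U)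
    show "k n 1 * U n = k (Suc n) 0 * U (Suc n)" for n
      by (simp add: k mult.assoc unitariesD[OF U(1)])
    show "k n t * U n \<in> unitaries" if "t \<in> {0..1}" for n t
      using that k(4) U(1) by (intro unitaries_mult)
    show "\<pi> a * (k n t * U n) = k n t * U n * \<rho> a" if "t \<in> {0..1}" "a \<in> T n" for n t a
      using k(5)[OF that] U(2)[OF that(2)] by (metis mult.assoc)
  qed
qed

lemma path_component_unitary_orbit_closure:
  fixes \<pi> \<rho> :: "'a::unital_cstar_algebra \<Rightarrow> 'b::unital_cstar_algebra"
  assumes af: "AF_alg TYPE('a)" and huc: "property_HUC TYPE('b)" and \<pi>: "\<pi> \<in> Rep"
    and \<rho>: "\<rho> \<in> unitary_orbit_closure \<pi>"
  shows "path_component (unitary_orbit_closure \<pi>) \<pi> \<rho>"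
proof -
  have \<rho>R: "\<rho> \<in> Rep" using \<rho> by (simp add: unitary_orbit_closure_def)
  obtain T :: "nat \<Rightarrow> 'a set" where T: "\<And>n. fd_unital_subalgebra (T n)" "\<And>n. T n \<subseteq> T (Suc n)"
    "T 0 = range (\<lambda>c. c *\<^sub>C 1)" "closure (\<Union>n. T n) = UNIV"
    using AF_alg_unital_chain[OF af] by blast
  obtain g :: "nat \<Rightarrow> real \<Rightarrow> 'b" where g: "\<And>n. continuous_on {0..1} (g n)" "g 0 0 = 1"
    "\<And>n. g n 1 = g (Suc n) 0" "\<And>n t. t \<in> {0..1} \<Longrightarrow> g n t \<in> unitaries"
    "\<And>n t a. t \<in> {0..1} \<Longrightarrow> a \<in> T n \<Longrightarrow> \<pi> a * g n t = g n t * \<rho> a"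
    using intertwining_unitary_paths[OF huc \<pi> \<rho> T(1-3)] by blast
  define u where "u s = g (nat \<lfloor>s\<rfloor>) (s - real (nat \<lfloor>s\<rfloor>))" for s
  have ucont: "continuous_on {0..real n} u" for n
    unfolding u_def[abs_def] using continuous_on_concatenation[of g, OF g(1,3)] .
  have frac: "s - real (nat \<lfloor>s\<rfloor>) \<in> {0..1}" if "s \<ge> 0" for s
    using that by (simp add: of_nat_nat) linarith
  have uU: "u s \<in> unitaries" if "s \<ge> 0" for s
    unfolding u_def using frac[OF that] by (rule g(4))
  have u\<rho>: "adj (u s) * \<pi> a * u s = \<rho> a" if "a \<in> T n" "s \<ge> real n" for s a n
  proof -
    have s: "s \<ge> 0" "n \<le> nat \<lfloor>s\<rfloor>" using that(2) by (auto simp: le_nat_floor intro: order_trans[of 0 "real n"])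
    then have "a \<in> T (nat \<lfloor>s\<rfloor>)" using that(1) lift_Suc_mono_le[of T, OF T(2)] by blast
    then have "\<pi> a * u s = u s * \<rho> a" unfolding u_def using g(5)[OF frac[OF s(1)]] by blast
    then show ?thesis by (simp add: mult.assoc unitariesD[OF uU[OF s(1)]])
  qed
  \<comment> \<open>The map t \<mapsto> t / (1 - t) stretches [0,1) over the half-line on which
    \<open>u\<close> lives; \<rho> is simply inserted at t = 1, and continuity there has to be shown
    pointwise in a.\<close>
  define \<Phi> where "\<Phi> t = (if t < 1 then (\<lambda>a. adj (u (t / (1 - t))) * \<pi> a * u (t / (1 - t))) else \<rho>)" for t :: real
  have \<Phi>mem: "\<Phi> t \<in> unitary_orbit_closure \<pi>" if "t \<in> {0..1}" for t
    unfolding \<Phi>_def using that \<rho> by (auto intro!: unitary_orbit_closure_conjugate \<pi> uU)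
  then have \<Phi>R: "\<Phi> t \<in> Rep" if "t \<in> {0..1}" for t
    using that by (auto simp: unitary_orbit_closure_def)
  have dense_cont: "continuous_on {0..1} (\<lambda>t. \<Phi> t a)" if a: "a \<in> T n" for a n
  proof -
    \<comment> \<open>This is the parameter with c / (1 - c) = n. For a in \<open>T n\<close> the
      path is a finite concatenation up to c and constantly \<rho> a afterwards.\<close>
    define c where "c = real n / (real n + 1)"
    have c: "0 \<le> c" "c < 1" by (auto simp: c_def)
    have lt: "t / (1 - t) \<le> real n \<longleftrightarrow> t \<le> c" if "t < 1" for t
      using that by (simp add: c_def field_simps)
    have "continuous_on {0..c} (\<lambda>t. u (t / (1 - t)))"
    proof (rule continuous_on_compose2[OF ucont[of n]])
      show "continuous_on {0..c} (\<lambda>t. t / (1 - t))" using c by (intro continuous_intros) auto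
      show "(\<lambda>t. t / (1 - t)) ` {0..c} \<subseteq> {0..real n}" using c lt by auto
    qed
    then have "continuous_on {0..c} (\<lambda>t. adj (u (t / (1 - t))) * \<pi> a * u (t / (1 - t)))"
      by (intro continuous_intros)
    then have "continuous_on {0..c} (\<lambda>t. \<Phi> t a)"
      using c by (elim continuous_on_eq) (auto simp: \<Phi>_def)
    moreover have "\<Phi> t a = \<rho> a" if "t \<in> {c..1}" for t
    proof (cases "t < 1")
      case True
      then have "real n \<le> t / (1 - t)" using that c lt[of t] by (simp add: c_def field_simps)
      then show ?thesis using u\<rho>[OF a] True by (simp add: \<Phi>_def)
    qed (simp add: \<Phi>_def)
    then have "continuous_on {c..1} (\<lambda>t. \<Phi> t a)"
      by (intro continuous_on_eq[OF continuous_on_const[of _ "\<rho> a"]]) auto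
    ultimately have "continuous_on ({0..c} \<union> {c..1}) (\<lambda>t. \<Phi> t a)"
      by (intro continuous_on_closed_Un) auto
    moreover have "{0..c} \<union> {c..1} = {0..1}" using c by auto
    ultimately show ?thesis by simp
  qed
  have cont: "continuous_on {0..1} (\<lambda>t. \<Phi> t a)" for a
  proof -
    have "a \<in> closure (\<Union>n. T n)" using T(4) by simp
    then obtain x where x: "\<And>k. x k \<in> (\<Union>n. T n)" "x \<longlonglongrightarrow> a"
      unfolding closure_sequential by blast
    \<comment> \<open>Each \<open>\<Phi> t\<close> is contractive, so approximating a from the dense
      union is uniform in t, and continuity passes to the limit.\<close>
    have "uniform_limit {0..1} (\<lambda>k t. \<Phi> t (x k)) (\<lambda>t. \<Phi> t a) sequentially"
    proof (rule uniform_limitI)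
      fix e :: real assume "e > 0"
      have "\<forall>\<^sub>F k in sequentially. dist (x k) a < e" using tendstoD[OF x(2) \<open>e > 0\<close>] .
      then show "\<forall>\<^sub>F k in sequentially. \<forall>t\<in>{0..1}. dist (\<Phi> t (x k)) (\<Phi> t a) < e"
      proof eventually_elim
        case (elim k)
        have "dist (\<Phi> t (x k)) (\<Phi> t a) \<le> dist (x k) a" if "t \<in> {0..1}" for t
          using norm_Rep_le[OF \<Phi>R[OF that], of "x k - a"] Rep_diff[OF \<Phi>R[OF that]] by (simp add: dist_norm)
        then show ?case using elim by (meson order_le_less_trans)
      qed
    qed
    moreover have "\<forall>\<^sub>F k in sequentially. continuous_on {0..1} (\<lambda>t. \<Phi> t (x k))"
      using x(1) dense_cont by (intro always_eventually) blast
    ultimately show ?thesis by (intro uniform_limit_theorem) auto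
  qed
  have "path \<Phi>" unfolding path_def by (rule continuous_on_coordinatewise_then_product) (rule cont)
  moreover have "path_image \<Phi> \<subseteq> unitary_orbit_closure \<pi>" using \<Phi>mem by (auto simp: path_image_def)
  moreover have "u 0 = 1" by (simp add: u_def g)
  then have "pathstart \<Phi> = \<pi>" by (simp add: pathstart_def \<Phi>_def)
  moreover have "pathfinish \<Phi> = \<rho>" by (simp add: pathfinish_def \<Phi>_def)
  ultimately show ?thesis unfolding path_component_def by blast
qed

theorem mainTheorem2:
  fixes \<pi> :: "'a::unital_cstar_algebra \<Rightarrow> 'b::unital_cstar_algebra"
  assumes "separable_alg TYPE('a)"
    and "AF_alg TYPE('a)"
    and "property_HUC TYPE('b)"
    and "\<pi> \<in> Rep"
  shows "path_connected (unitary_orbit_closure \<pi>)"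
  unfolding path_connected_component
  using path_component_unitary_orbit_closure[OF assms(2-4)]
  by (meson path_component_sym path_component_trans)

end
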